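(* Let $c>2$ be a fixed constant. There is an algorithm that, given a $\Pi_m\Sigma_s$ polynomial in $n$ variables, decides in $O(cms\sqrt{m+cn})$ time whether it has a $c$-monomial in its sum-product expansion.
   Context: Polynomials are in variables $x_1,\dots,x_n$. A monomial $x_{i_1}^{j_1}\cdots x_{i_k}^{j_k}$ with $i_1<\dots<i_k$ is a $c$-monomial if $1\le j_1,\dots,j_k<c$. A $\Pi_m\Sigma_s$ polynomial is given as a product of $m$ clauses, each a sum of at most $s$ single variables. The monomials of its sum-product expansion are the products obtained by choosing one variable from each clause; it has a $c$-monomial in its sum-product expansion if some such product is a $c$-monomial. *)

theory Defs
  imports Complex_Main "HOL-Library.Poly_Mapping"
begin

section \<open>Product-of-sums polynomials and c-monomials\<close>

text \<open>
  A monomial in the variables \<open>x\<^sub>1, x\<^sub>2, \<dots>\<close> is its finitely supported exponent vector, so the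
  product of monomials is the sum of exponent vectors, and the variables that occur in a monomial
  are its keys.
\<close>

type_synonym monomial = "nat \<Rightarrow>\<^sub>0 nat"

definition var_mon :: "nat \<Rightarrow> monomial" where
  "var_mon i = Poly_Mapping.single i 1"

definition is_c_monomial :: "nat \<Rightarrow> monomial \<Rightarrow> bool" where
  "is_c_monomial c \<mu> \<longleftrightarrow>
     (\<forall>i \<in> Poly_Mapping.keys \<mu>. 1 \<le> Poly_Mapping.lookup \<mu> i \<and> Poly_Mapping.lookup \<mu> i < c)"

text \<open>
  A clause is the list of (indices of) its summands, a polynomial is the list of its clauses.
  A variable may be repeated within a clause, and an empty clause is the empty sum.
\<close>

definition is_pi_sigma :: "nat \<Rightarrow> nat \<Rightarrow> nat \<Rightarrow> nat list list \<Rightarrow> bool" where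
  "is_pi_sigma n m s F \<longleftrightarrow>
     length F = m \<and> (\<forall>C \<in> set F. length C \<le> s \<and> set C \<subseteq> {1..n})"

definition expansion_monomials :: "nat list list \<Rightarrow> monomial set" where
  "expansion_monomials F =
     {sum_list (map var_mon xs) | xs. list_all2 (\<lambda>x C. x \<in> set C) xs F}"

definition has_c_monomial :: "nat \<Rightarrow> nat list list \<Rightarrow> bool" where
  "has_c_monomial c F \<longleftrightarrow> (\<exists>\<mu> \<in> expansion_monomials F. is_c_monomial c \<mu>)"


section \<open>A unit-cost random access machine\<close>

text \<open>
  The store is a family of arrays of natural numbers. Array names are literals of the program text,
  so that a program uses only finitely many arrays (interleaving them gives a single memory); indices
  are computed at run time, which is indirect addressing. A scalar register is a cell with a literal
  index. The arithmetic operations are addition and truncated subtraction; as usual for the unit-cost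
  measure, there is no multiplication.
\<close>

type_synonym store = "nat \<Rightarrow> nat \<Rightarrow> nat"

datatype expr = Const nat | Cell nat expr | Add expr expr | Sub expr expr

datatype test = Less expr expr | Neg test | Conj test test

datatype prog =
    Skip
  | Assign nat expr expr
  | Seq prog prog
  | Cond test prog prog
  | While test prog

fun expr_val :: "expr \<Rightarrow> store \<Rightarrow> nat" where
  "expr_val (Const k) \<sigma> = k"
| "expr_val (Cell a e) \<sigma> = \<sigma> a (expr_val e \<sigma>)"
| "expr_val (Add e\<^sub>1 e\<^sub>2) \<sigma> = expr_val e\<^sub>1 \<sigma> + expr_val e\<^sub>2 \<sigma>"
| "expr_val (Sub e\<^sub>1 e\<^sub>2) \<sigma> = expr_val e\<^sub>1 \<sigma> - expr_val e\<^sub>2 \<sigma>"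

fun test_val :: "test \<Rightarrow> store \<Rightarrow> bool" where
  "test_val (Less e\<^sub>1 e\<^sub>2) \<sigma> \<longleftrightarrow> expr_val e\<^sub>1 \<sigma> < expr_val e\<^sub>2 \<sigma>"
| "test_val (Neg b) \<sigma> \<longleftrightarrow> \<not> test_val b \<sigma>"
| "test_val (Conj b\<^sub>1 b\<^sub>2) \<sigma> \<longleftrightarrow> test_val b\<^sub>1 \<sigma> \<and> test_val b\<^sub>2 \<sigma>"

text \<open>
  Every constant, memory access, arithmetic operation, comparison and Boolean connective costs one
  time unit per evaluation; there is no short-circuit evaluation, so these costs do not depend on
  the store.
\<close>

fun expr_cost :: "expr \<Rightarrow> nat" where
  "expr_cost (Const k) = 1"
| "expr_cost (Cell a e) = 1 + expr_cost e"
| "expr_cost (Add e\<^sub>1 e\<^sub>2) = 1 + expr_cost e\<^sub>1 + expr_cost e\<^sub>2"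
| "expr_cost (Sub e\<^sub>1 e\<^sub>2) = 1 + expr_cost e\<^sub>1 + expr_cost e\<^sub>2"

fun test_cost :: "test \<Rightarrow> nat" where
  "test_cost (Less e\<^sub>1 e\<^sub>2) = 1 + expr_cost e\<^sub>1 + expr_cost e\<^sub>2"
| "test_cost (Neg b) = 1 + test_cost b"
| "test_cost (Conj b\<^sub>1 b\<^sub>2) = 1 + test_cost b\<^sub>1 + test_cost b\<^sub>2"

text \<open>
  \<open>run P \<sigma> t \<tau>\<close>: started in store \<open>\<sigma>\<close>, the program \<open>P\<close> terminates after exactly \<open>t\<close> time units in
  store \<open>\<tau>\<close>. In \<open>Assign a i e\<close> the cell of array \<open>a\<close> at the value of \<open>i\<close> receives the value of \<open>e\<close>.
\<close>

inductive run :: "prog \<Rightarrow> store \<Rightarrow> nat \<Rightarrow> store \<Rightarrow> bool" where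
  run_Skip: "run Skip \<sigma> 1 \<sigma>"
| run_Assign: "run (Assign a i e) \<sigma> (1 + expr_cost i + expr_cost e)
     (\<sigma>(a := (\<sigma> a)(expr_val i \<sigma> := expr_val e \<sigma>)))"
| run_Seq: "run P \<sigma> t \<rho> \<Longrightarrow> run Q \<rho> u \<tau> \<Longrightarrow> run (Seq P Q) \<sigma> (t + u) \<tau>"
| run_Cond_True: "test_val b \<sigma> \<Longrightarrow> run P \<sigma> t \<tau> \<Longrightarrow> run (Cond b P Q) \<sigma> (1 + test_cost b + t) \<tau>"
| run_Cond_False: "\<not> test_val b \<sigma> \<Longrightarrow> run Q \<sigma> t \<tau> \<Longrightarrow> run (Cond b P Q) \<sigma> (1 + test_cost b + t) \<tau>"
| run_While_True: "test_val b \<sigma> \<Longrightarrow> run P \<sigma> t \<rho> \<Longrightarrow> run (While b P) \<rho> u \<tau> \<Longrightarrow>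
     run (While b P) \<sigma> (1 + test_cost b + t + u) \<tau>"
| run_While_False: "\<not> test_val b \<sigma> \<Longrightarrow> run (While b P) \<sigma> (1 + test_cost b) \<sigma>"

inductive_cases run_SkipE: "run Skip \<sigma> t \<tau>"
inductive_cases run_AssignE: "run (Assign a i e) \<sigma> t \<tau>"
inductive_cases run_SeqE: "run (Seq P Q) \<sigma> t \<tau>"
inductive_cases run_CondE: "run (Cond b P Q) \<sigma> t \<tau>"
inductive_cases run_WhileE: "run (While b P) \<sigma> t \<tau>"

lemma run_deterministic:
  "run P \<sigma> t \<tau> \<Longrightarrow> run P \<sigma> t' \<tau>' \<Longrightarrow> t = t' \<and> \<tau> = \<tau>'"
proof (induction arbitrary: t' \<tau>' rule: run.induct)
  case (run_Seq P \<sigma> t \<rho> Q u \<tau>)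
  from run_Seq.prems show ?case
    by (rule run_SeqE) (auto dest!: run_Seq.IH)
next
  case (run_Cond_True b \<sigma> P t \<tau> Q)
  from run_Cond_True.prems show ?case
    by (rule run_CondE) (auto simp: run_Cond_True.hyps dest: run_Cond_True.IH)
next
  case (run_Cond_False b \<sigma> Q t \<tau> P)
  from run_Cond_False.prems show ?case
    by (rule run_CondE) (auto simp: run_Cond_False.hyps dest: run_Cond_False.IH)
next
  case (run_While_True b \<sigma> P t \<rho> u \<tau>)
  from run_While_True.prems show ?case
    by (rule run_WhileE) (auto simp: run_While_True.hyps dest!: run_While_True.IH)
next
  case (run_While_False b \<sigma> P)
  from run_While_False.prems show ?case
    by (rule run_WhileE) (auto simp: run_While_False.hyps)
qed (auto elim: run_SkipE run_AssignE)

text \<open>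
  The input word is in array 0, all other cells are initially 0, and the answer is read from the
  first cell of array 1.
\<close>

definition input_store :: "nat list \<Rightarrow> store" where
  "input_store w = (\<lambda>a i. if a = 0 \<and> i < length w then w ! i else 0)"

definition decides_within :: "prog \<Rightarrow> nat list \<Rightarrow> bool \<Rightarrow> real \<Rightarrow> bool" where
  "decides_within P w answer T \<longleftrightarrow>
     (\<exists>t \<tau>. run P (input_store w) t \<tau> \<and> real t \<le> T \<and> \<tau> 1 0 = (if answer then 1 else 0))"

text \<open>The number of variables, the number of clauses, and then each clause preceded by its length.\<close>

definition encode :: "nat \<Rightarrow> nat list list \<Rightarrow> nat list" where
  "encode n F = n # length F # concat (map (\<lambda>C. length C # C) F)"

end

theory Submission
  imports Defs
begin

text \<open>
  Replacing every variable by \<open>c - 1\<close> copies turns the question into whether a bipartite graph with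
  the \<open>m\<close> clauses as left vertices and at most \<open>(c - 1) m s\<close> edges has a matching that saturates the
  clauses. With \<open>L\<close> the least number such that \<open>m \<le> L\<^sup>2\<close>, an auction first computes a partial
  matching: an unmatched clause takes its cheapest copy, evicts the present owner and raises the
  price by one, and it is given up if all its copies cost \<open>L\<close>. Only matched copies have a
  positive price, so there are at most \<open>m L\<close> bids. By linear programming duality, at most
  \<open>m / L \<le> L\<close> clauses are given up if a saturating matching exists. For each of them, one
  breadth-first search either yields an augmenting path or finds a set of clauses with too few
  neighbours.
\<close>

section \<open>Time-bounded total correctness\<close>

text \<open>The choice of \<open>L\<close> balances the two phases. Scanning a clause costs O(c s),
  so the auction costs O(c m s L); a search scans each clause at most once, so \<open>L\<close>
  searches cost O(c m s L) as well. With \<open>L\<close> about sqrt m this is O(c m s sqrt m),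
  without the layers of shortest augmenting paths of Hopcroft and Karp. The number of variables does
  not enter the time: copies are reached through edges only, all cells start at 0, and visited marks
  are stamps that are never cleared. The bound on given-up clauses presupposes a saturating
  matching, so a larger number of them already settles the answer without any search. The lack of
  multiplication shapes the code: copies are numbered by repeated addition and \<open>L\<close> is
  found by adding odd numbers.\<close>

definition exec :: "prog \<Rightarrow> store \<Rightarrow> nat \<Rightarrow> (store \<Rightarrow> bool) \<Rightarrow> bool" where
  "exec P \<sigma> T Q \<longleftrightarrow> (\<exists>t \<tau>. run P \<sigma> t \<tau> \<and> t \<le> T \<and> Q \<tau>)"

text \<open>Array names are literals, so the arrays that a program may change can be read off its
  text. With \<open>agree_off\<close> this gives a frame rule: loop invariants need not mention what
  the loop leaves alone.\<close>

fun writes :: "prog \<Rightarrow> nat set" where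
  "writes Skip = {}"
| "writes (Assign a i e) = {a}"
| "writes (Seq P Q) = writes P \<union> writes Q"
| "writes (Cond b P Q) = writes P \<union> writes Q"
| "writes (While b P) = writes P"

definition agree_off :: "nat set \<Rightarrow> store \<Rightarrow> store \<Rightarrow> bool" where
  "agree_off A \<sigma> \<tau> \<longleftrightarrow> (\<forall>a. a \<notin> A \<longrightarrow> \<tau> a = \<sigma> a)"

lemma agree_off_refl [simp]: "agree_off A \<sigma> \<sigma>"
  by (simp add: agree_off_def)

lemma agree_offD: "agree_off A \<sigma> \<tau> \<Longrightarrow> a \<notin> A \<Longrightarrow> \<tau> a = \<sigma> a"
  by (simp add: agree_off_def)

lemma agree_off_trans: "agree_off A \<sigma> \<rho> \<Longrightarrow> agree_off A \<rho> \<tau> \<Longrightarrow> agree_off A \<sigma> \<tau>"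
  by (simp add: agree_off_def)

lemma run_agree_off: "run P \<sigma> t \<tau> \<Longrightarrow> agree_off (writes P) \<sigma> \<tau>"
  by (induction rule: run.induct) (auto simp: agree_off_def)

lemma exec_mono:
  assumes "exec P \<sigma> T Q" "T \<le> T'" "\<And>\<tau>. Q \<tau> \<Longrightarrow> agree_off (writes P) \<sigma> \<tau> \<Longrightarrow> Q' \<tau>"
  shows "exec P \<sigma> T' Q'"
  using assms run_agree_off unfolding exec_def by (meson le_trans)

lemma exec_Seq:
  assumes "exec P \<sigma> T Q"
    and "\<And>\<rho>. Q \<rho> \<Longrightarrow> agree_off (writes P) \<sigma> \<rho> \<Longrightarrow> exec P' \<rho> T' Q'"
  shows "exec (Seq P P') \<sigma> (T + T') Q'"
proof -
  obtain t \<rho> where 1: "run P \<sigma> t \<rho>" "t \<le> T" "Q \<rho>"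
    using assms(1) by (auto simp: exec_def)
  then obtain u \<tau> where "run P' \<rho> u \<tau>" "u \<le> T'" "Q' \<tau>"
    using assms(2) run_agree_off by (metis exec_def)
  with 1 show ?thesis
    unfolding exec_def by (meson add_mono run_Seq)
qed

lemma exec_Cond:
  assumes "test_val b \<sigma> \<Longrightarrow> exec P \<sigma> T Q" "\<not> test_val b \<sigma> \<Longrightarrow> exec P' \<sigma> T Q"
  shows "exec (Cond b P P') \<sigma> (1 + test_cost b + T) Q"
  using assms unfolding exec_def
  by (cases "test_val b \<sigma>") (meson add_le_mono run_Cond_True run_Cond_False le_refl)+

text \<open>The measure \<open>f\<close> serves for termination and time at once: each iteration is
  paid for by one unit of \<open>f\<close>, and the last summand is the final, failing test. The
  step may assume agreement with the store at loop entry.\<close>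

lemma exec_While:
  assumes "I \<sigma>"
    and step: "\<And>\<rho>. I \<rho> \<Longrightarrow> agree_off (writes P) \<sigma> \<rho> \<Longrightarrow> test_val b \<rho> \<Longrightarrow>
      exec P \<rho> T (\<lambda>\<tau>. I \<tau> \<and> f \<tau> < f \<rho>)"
  shows "exec (While b P) \<sigma> (f \<sigma> * (1 + test_cost b + T) + (1 + test_cost b))
    (\<lambda>\<tau>. I \<tau> \<and> \<not> test_val b \<tau>)"
proof -
  let ?c = "1 + test_cost b + T"
  have "I \<rho> \<Longrightarrow> agree_off (writes P) \<sigma> \<rho> \<Longrightarrow>
    exec (While b P) \<rho> (f \<rho> * ?c + (1 + test_cost b)) (\<lambda>\<tau>. I \<tau> \<and> \<not> test_val b \<tau>)" for \<rho>
  proof (induction "f \<rho>" arbitrary: \<rho> rule: less_induct)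
    case less
    show ?case
    proof (cases "test_val b \<rho>")
      case False
      then show ?thesis
        unfolding exec_def
        using less.prems(1) run_While_False[OF False, of P]
        by (intro exI[of _ "1 + test_cost b"] exI[of _ \<rho>]) auto
    next
      case True
      then obtain t \<upsilon> where 1: "run P \<rho> t \<upsilon>" "t \<le> T" "I \<upsilon>" "f \<upsilon> < f \<rho>"
        using step[OF less.prems True] by (auto simp: exec_def)
      have "agree_off (writes P) \<sigma> \<upsilon>"
        using run_agree_off[OF 1(1)] less.prems(2) agree_off_trans by blast
      then obtain u \<tau> where 2: "run (While b P) \<upsilon> u \<tau>" "u \<le> f \<upsilon> * ?c + (1 + test_cost b)"
        "I \<tau> \<and> \<not> test_val b \<tau>"
        using less.hyps[OF 1(4,3)] by (auto simp: exec_def)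
      have "Suc (f \<upsilon>) * ?c \<le> f \<rho> * ?c"
        using 1(4) by (intro mult_right_mono) simp_all
      then have "1 + test_cost b + t + u \<le> f \<rho> * ?c + (1 + test_cost b)"
        using 1(2) 2(2) by simp
      then show ?thesis
        unfolding exec_def using run_While_True[OF True 1(1) 2(1)] 2(3) by blast
    qed
  qed
  then show ?thesis
    using assms(1) by simp
qed

section \<open>Loop-free programs\<close>

fun straight :: "prog \<Rightarrow> bool" where
  "straight Skip \<longleftrightarrow> True"
| "straight (Assign a i e) \<longleftrightarrow> True"
| "straight (Seq P Q) \<longleftrightarrow> straight P \<and> straight Q"
| "straight (Cond b P Q) \<longleftrightarrow> straight P \<and> straight Q"
| "straight (While b P) \<longleftrightarrow> False"

fun effect :: "prog \<Rightarrow> store \<Rightarrow> store" where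
  "effect Skip \<sigma> = \<sigma>"
| "effect (Assign a i e) \<sigma> = \<sigma>(a := (\<sigma> a)(expr_val i \<sigma> := expr_val e \<sigma>))"
| "effect (Seq P Q) \<sigma> = effect Q (effect P \<sigma>)"
| "effect (Cond b P Q) \<sigma> = (if test_val b \<sigma> then effect P \<sigma> else effect Q \<sigma>)"
| "effect (While b P) \<sigma> = \<sigma>"

fun max_cost :: "prog \<Rightarrow> nat" where
  "max_cost Skip = 1"
| "max_cost (Assign a i e) = 1 + expr_cost i + expr_cost e"
| "max_cost (Seq P Q) = max_cost P + max_cost Q"
| "max_cost (Cond b P Q) = 1 + test_cost b + max (max_cost P) (max_cost Q)"
| "max_cost (While b P) = 0"

text \<open>Code without loops needs no intermediate assertions, since the simplifier can compute
  \<open>effect\<close>. The time bound charges the dearer branch of each conditional.\<close>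

lemma exec_straight:
  assumes "straight P" "Q (effect P \<sigma>)"
  shows "exec P \<sigma> (max_cost P) Q"
proof -
  have "straight P \<Longrightarrow> \<exists>t\<le>max_cost P. run P \<sigma> t (effect P \<sigma>)"
  proof (induction P arbitrary: \<sigma>)
    case (Seq P Q)
    then show ?case
      by (metis add_mono effect.simps(3) max_cost.simps(3) run_Seq straight.simps(3))
  next
    case (Cond b P Q)
    then obtain t u where "t \<le> max_cost P" "run P \<sigma> t (effect P \<sigma>)"
      "u \<le> max_cost Q" "run Q \<sigma> u (effect Q \<sigma>)"
      by (meson straight.simps(4))
    then show ?case
      using run_Cond_True[of b \<sigma> P t "effect P \<sigma>" Q] run_Cond_False[of b \<sigma> Q u "effect Q \<sigma>" P]
      by (intro exI[of _ "1 + test_cost b + (if test_val b \<sigma> then t else u)"]) auto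
  next
    case Skip
    then show ?case
      using run_Skip by auto
  next
    case (Assign a i e)
    then show ?case
      using run_Assign[of a i e \<sigma>]
      by (intro exI[of _ "1 + expr_cost i + expr_cost e"]) (simp del: fun_upd_apply)
  qed simp
  with assms show ?thesis
    by (auto simp: exec_def)
qed

lemma exec_step:
  assumes "straight P" "max_cost P \<le> T" "Q (effect P \<sigma>)"
  shows "exec P \<sigma> T Q"
  using exec_mono[OF exec_straight[of P Q \<sigma>, OF assms(1,3)] assms(2)] by simp

lemma exec_Seq_step:
  assumes "straight P" "exec P' (effect P \<sigma>) T Q"
  shows "exec (Seq P P') \<sigma> (max_cost P + T) Q"
  using exec_Seq[OF exec_straight[OF assms(1), of "\<lambda>\<rho>. \<rho> = effect P \<sigma>"]] assms(2) by simp

section \<open>Bipartite matchings\<close>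

definition saturable :: "nat \<Rightarrow> (nat \<Rightarrow> nat set) \<Rightarrow> bool" where
  "saturable m N \<longleftrightarrow> (\<exists>f. inj_on f {..<m} \<and> (\<forall>u<m. f u \<in> N u))"

definition matched :: "(nat \<Rightarrow> nat) \<Rightarrow> nat set" where
  "matched mate = {u. \<exists>v. mate v = Suc u}"

lemma matchedI: "mate v = Suc u \<Longrightarrow> u \<in> matched mate"
  by (auto simp: matched_def)

lemma matched_0 [simp]: "matched (\<lambda>_. 0) = {}"
  by (simp add: matched_def)

lemma mem_matched_update:
  "y \<in> matched (mate(v := x)) \<longleftrightarrow> x = Suc y \<or> (\<exists>b. b \<noteq> v \<and> mate b = Suc y)"
  by (auto simp: matched_def)

text \<open>
  The left vertices of a bipartite graph are the numbers below \<open>m\<close>. As in the memory of the machine,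
  \<open>mate v = 0\<close> says that the right vertex \<open>v\<close> is free and \<open>mate v = Suc u\<close> that it is matched to \<open>u\<close>,
  whereas \<open>match u\<close> is meaningful for matched \<open>u\<close> only.
\<close>

locale matching =
  fixes m :: nat and N :: "nat \<Rightarrow> nat set" and mate match :: "nat \<Rightarrow> nat"
  assumes mate_less: "mate v = Suc u \<Longrightarrow> u < m"
    and mate_mem: "mate v = Suc u \<Longrightarrow> v \<in> N u"
    and match_mate: "mate v = Suc u \<Longrightarrow> match u = v"
begin

lemma mate_match: "u \<in> matched mate \<Longrightarrow> mate (match u) = Suc u"
  using match_mate by (auto simp: matched_def)

lemma matched_subset: "matched mate \<subseteq> {..<m}"
  using mate_less by (auto simp: matched_def)

lemma finite_matched: "finite (matched mate)"
  using matched_subset finite_subset by blast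

lemma inj_on_match: "inj_on match (matched mate)"
  by (metis inj_onI mate_match old.nat.inject)

lemma match_image: "mate v \<noteq> 0 \<Longrightarrow> v \<in> match ` matched mate"
  by (metis image_eqI match_mate matchedI not0_implies_Suc)

lemma saturableI:
  assumes "{..<m} \<subseteq> matched mate"
  shows "saturable m N"
proof -
  have "matched mate = {..<m}"
    using assms matched_subset by blast
  then show ?thesis
    unfolding saturable_def
    using inj_on_match mate_match mate_mem by (metis lessThan_iff)
qed

end

text \<open>The easy half of Hall's theorem: an injection cannot send \<open>t\<close> vertices to
  \<open>t - 1\<close> values. The index set \<open>{1..<t}\<close> anticipates the search, where
  every queue entry except the root accounts for one neighbour.\<close>

lemma not_saturable_if_few_neighbours:
  fixes t :: nat
  assumes "inj_on Q {..<t}" "\<And>p. p < t \<Longrightarrow> Q p < m" "0 < t"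
    and "(\<Union>p<t. N (Q p)) \<subseteq> g ` {1..<t}"
  shows "\<not> saturable m N"
proof
  assume "saturable m N"
  then obtain f where f: "inj_on f {..<m}" "\<And>u. u < m \<Longrightarrow> f u \<in> N u"
    by (auto simp: saturable_def)
  have inj: "inj_on (f \<circ> Q) {..<t}"
    by (rule comp_inj_on[OF assms(1)]) (use f(1) assms(2) in \<open>auto intro: inj_on_subset\<close>)
  have sub: "(f \<circ> Q) ` {..<t} \<subseteq> g ` {1..<t}"
    using assms(2,4) f(2) by fastforce
  have "card {..<t} = card ((f \<circ> Q) ` {..<t})"
    by (simp only: card_image[OF inj])
  also have "\<dots> \<le> card (g ` {1..<t})"
    using sub by (intro card_mono) simp_all
  also have "\<dots> \<le> card {1..<t}"
    by (intro card_image_le) simp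
  finally show False
    using assms(3) by simp
qed

text \<open>
  \<open>market\<close> is the invariant of the auction: \<open>give\<close> lists the \<open>k\<close> left vertices that have been given
  up, and \<open>T\<close> is the set of those that have yet to be treated.
\<close>

locale market = matching m N mate match
  for m N mate match +
  fixes L :: nat and price give :: "nat \<Rightarrow> nat" and k :: nat and T :: "nat set"
  assumes free_price: "mate v = 0 \<Longrightarrow> price v = 0"
    and slack: "mate v = Suc u \<Longrightarrow> w \<in> N u \<Longrightarrow> price v \<le> Suc (price w)"
    and price_le: "price v \<le> L"
    and inj_give: "inj_on give {..<k}"
    and give_less: "j < k \<Longrightarrow> give j < m"
    and give_unmatched: "j < k \<Longrightarrow> give j \<notin> matched mate"
    and give_dear: "j < k \<Longrightarrow> w \<in> N (give j) \<Longrightarrow> L \<le> price w"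
    and todo_less: "u \<in> T \<Longrightarrow> u < m"
    and todo_unmatched: "u \<in> T \<Longrightarrow> u \<notin> matched mate"
    and todo_not_given: "u \<in> T \<Longrightarrow> u \<notin> give ` {..<k}"
    and covered: "u < m \<Longrightarrow> u \<in> T \<or> u \<in> give ` {..<k} \<or> u \<in> matched mate"
begin

lemma give_up:
  assumes "u \<in> T" "\<And>w. w \<in> N u \<Longrightarrow> L \<le> price w"
  shows "market m N mate match L price (give(k := u)) (Suc k) (T - {u})"
proof -
  have img: "(give(k := u)) ` {..<Suc k} = insert u (give ` {..<k})"
    by (auto simp: image_iff less_Suc_eq)
  have "inj_on (give(k := u)) {..<Suc k}"
    using inj_give todo_not_given[OF assms(1)]
    by (simp add: lessThan_Suc inj_on_fun_updI)
  then show ?thesis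
  proof unfold_locales
    fix y assume "y \<in> T - {u}"
    then show "y \<notin> (give(k := u)) ` {..<Suc k}"
      unfolding img using todo_not_given by blast
  next
    fix y assume "y < m"
    then show "y \<in> T - {u} \<or> y \<in> (give(k := u)) ` {..<Suc k} \<or> y \<in> matched mate"
      unfolding img using covered by blast
  qed (use free_price slack price_le give_less give_unmatched give_dear todo_less todo_unmatched
      assms in \<open>auto simp: less_Suc_eq split: if_splits\<close>)
qed

text \<open>Since \<open>v\<close> is a cheapest neighbour of \<open>u\<close>, its raised price
  exceeds that of any neighbour of \<open>u\<close> by at most one; for the other owners
  \<open>slack\<close> can only gain, as prices never fall. A copy once taken is only passed on, so
  free copies keep price 0.\<close>

lemma bid:
  assumes "u \<in> T" "v \<in> N u" "price v < L"
    and min: "\<And>w. w \<in> N u \<Longrightarrow> price v \<le> price w"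
  shows "market m N (mate(v := Suc u)) (match(u := v)) L (price(v := Suc (price v))) give k
    (T - {u} \<union> {y. mate v = Suc y})"
proof -
  note u = todo_less[OF assms(1)] todo_unmatched[OF assms(1)] todo_not_given[OF assms(1)]
  have u': "mate w \<noteq> Suc u" for w
    using u(2) matchedI by blast
  \<comment> \<open>An evicted owner of \<open>v\<close> becomes unmatched altogether, because
    \<open>match\<close> allows it no second partner.\<close>
  have new: "y \<in> matched (mate(v := Suc u)) \<longleftrightarrow> y = u \<or> y \<in> matched mate \<and> mate v \<noteq> Suc y" for y
    unfolding mem_matched_update unfolding matched_def mem_Collect_eq
    by (metis match_mate old.nat.inject)
  interpret new: matching m N "mate(v := Suc u)" "match(u := v)"
    using u u' mate_less mate_mem match_mate assms(2) by unfold_locales (auto split: if_splits)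
  show ?thesis
  proof unfold_locales
    fix w assume "(mate(v := Suc u)) w = 0"
    then show "(price(v := Suc (price v))) w = 0"
      using free_price by (auto split: if_splits)
  next
    fix w y x assume "(mate(v := Suc u)) w = Suc y" "x \<in> N y"
    then show "(price(v := Suc (price v))) w \<le> Suc ((price(v := Suc (price v))) x)"
      using min slack by (auto simp: le_SucI split: if_splits)
  next
    fix j assume j: "j < k"
    then show "give j \<notin> matched (mate(v := Suc u))"
      using give_unmatched u(3) by (auto simp: new)
    show "L \<le> (price(v := Suc (price v))) w" if "w \<in> N (give j)" for w
      using give_dear[OF j that] by (auto simp: le_SucI)
  next
    fix y assume "y \<in> T - {u} \<union> {y. mate v = Suc y}"
    then consider "y \<in> T" "y \<noteq> u" | "mate v = Suc y" "y \<noteq> u"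
      using u' by auto
    then show "y < m" "y \<notin> matched (mate(v := Suc u))" "y \<notin> give ` {..<k}"
      using todo_less todo_unmatched todo_not_given give_unmatched mate_less
      by (cases; auto simp: new dest: matchedI)+
  next
    fix y assume "y < m"
    then show "y \<in> T - {u} \<union> {y. mate v = Suc y} \<or> y \<in> give ` {..<k} \<or>
        y \<in> matched (mate(v := Suc u))"
      using covered unfolding new by blast
  qed (use price_le inj_give give_less assms(3) in auto)
qed

text \<open>A bid raises this sum by one, so it measures the progress of the auction. Prices are
  defined on all natural numbers, hence the finite set \<open>U\<close>; it will be the union of all
  neighbourhoods.\<close>

lemma sum_price_le:
  assumes "finite U"
  shows "(\<Sum>v\<in>U. price v) \<le> m * L"
proof -
  have "(\<Sum>v\<in>U. price v) = (\<Sum>v\<in>U \<inter> {v. mate v \<noteq> 0}. price v)"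
    using assms free_price by (intro sum.mono_neutral_right) auto
  also have "\<dots> \<le> (\<Sum>v\<in>match ` matched mate. price v)"
    using finite_matched match_image by (intro sum_mono2) auto
  also have "\<dots> \<le> card (match ` matched mate) * L"
    using sum_bounded_above[of "match ` matched mate" price L] price_le by simp
  also have "\<dots> \<le> m * L"
    using card_image_le[OF finite_matched, of match] card_mono[OF _ matched_subset]
    by (intro mult_right_mono) simp_all
  finally show ?thesis .
qed

text \<open>
  Linear programming duality: the right vertices used by a saturating matching cost no more in total
  than those that are currently matched. A matched vertex pays at most one more than it would pay in
  the saturating matching, where a given-up vertex would have to pay \<open>L\<close>.
\<close>

lemma given_up_le:
  assumes "T = {}" and "saturable m N"
  shows "k * L \<le> m"
proof -
  obtain f where f: "inj_on f {..<m}" "\<And>u. u < m \<Longrightarrow> f u \<in> N u"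
    using assms(2) by (auto simp: saturable_def)
  define G where "G = give ` {..<k}"
  define S where "S = matched mate"
  have part: "{..<m} = S \<union> G" "S \<inter> G = {}"
    using covered give_unmatched give_less matched_subset assms(1) by (auto simp: S_def G_def)
  have fin: "finite S" "finite G"
    by (auto simp: S_def G_def finite_matched)
  have "(\<Sum>u\<in>S. price (f u)) + (\<Sum>u\<in>G. price (f u)) = (\<Sum>u<m. price (f u))"
    using part fin by (simp add: sum.union_disjoint)
  also have "\<dots> = (\<Sum>v\<in>f ` {..<m}. price v)"
    using f(1) by (simp add: sum.reindex)
  \<comment> \<open>Free copies cost nothing, and by \<open>match_image\<close> each taken copy is
    the partner of a vertex in \<open>S\<close>.\<close>
  also have "\<dots> = (\<Sum>v\<in>f ` {..<m} \<inter> {v. mate v \<noteq> 0}. price v)"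
    using free_price by (intro sum.mono_neutral_right) auto
  also have "\<dots> \<le> (\<Sum>v\<in>match ` S. price v)"
    using fin match_image by (intro sum_mono2) (auto simp: S_def)
  also have "\<dots> = (\<Sum>u\<in>S. price (match u))"
    using inj_on_match by (simp add: S_def sum.reindex)
  also have "\<dots> \<le> (\<Sum>u\<in>S. price (f u) + 1)"
  proof (rule sum_mono)
    fix u assume "u \<in> S"
    then have "mate (match u) = Suc u" "u < m"
      using mate_match matched_subset by (auto simp: S_def)
    then show "price (match u) \<le> price (f u) + 1"
      using slack f(2) by fastforce
  qed
  also have "\<dots> = (\<Sum>u\<in>S. price (f u)) + card S"
    by (simp only: sum.distrib sum_constant) simp
  \<comment> \<open>The sum over \<open>S\<close> occurs on both sides and cancels, leaving one unit
    for each matched vertex.\<close>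
  finally have "(\<Sum>u\<in>G. price (f u)) \<le> card S"
    by simp
  moreover have "card G * L \<le> (\<Sum>u\<in>G. price (f u))"
    using sum_bounded_below[of G L "\<lambda>u. price (f u)"] give_dear give_less f(2)
    by (auto simp: G_def)
  moreover have "card S \<le> m"
    using card_mono[OF _ matched_subset] by (simp add: S_def)
  moreover have "card G = k"
    using inj_give by (simp add: G_def card_image)
  ultimately show ?thesis
    by simp
qed

end

lemma market_init: "market m N (\<lambda>_. 0) match L (\<lambda>_. 0) give 0 {..<m}"
  by unfold_locales auto

text \<open>
  \<open>search\<close> is the invariant of a breadth-first search for an augmenting path from \<open>u\<close>: the queue
  \<open>Q\<close> holds \<open>t\<close> left vertices, a right vertex \<open>v\<close> is visited if it carries the stamp \<open>z\<close>, and it has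
  then been reached from the entry of the queue at position \<open>par v\<close>. The visited vertices
  include \<open>X\<close>.
\<close>

locale search = matching m N mate match
  for m N mate match +
  fixes u z :: nat and vis par Q :: "nat \<Rightarrow> nat" and t found fv :: nat and X :: "nat set"
  assumes root: "u \<notin> matched mate"
    and nonempty: "0 < t"
    and Q_0: "Q 0 = u"
    and inj_Q: "inj_on Q {..<t}"
    and Q_less: "p < t \<Longrightarrow> Q p < m"
    and vis_match: "0 < p \<Longrightarrow> p < t \<Longrightarrow> vis (match (Q p)) = z"
    and Q_matched: "0 < p \<Longrightarrow> p < t \<Longrightarrow> Q p \<in> matched mate"
    and par_match: "0 < p \<Longrightarrow> p < t \<Longrightarrow> par (match (Q p)) < p"
    and par_less: "vis v = z \<Longrightarrow> par v < t"
    and mem_par: "vis v = z \<Longrightarrow> v \<in> N (Q (par v))"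
    and free_found: "vis v = z \<Longrightarrow> mate v = 0 \<Longrightarrow> 0 < found"
    and mate_queued: "vis v = z \<Longrightarrow> mate v = Suc y \<Longrightarrow> \<exists>p. 0 < p \<and> p < t \<and> Q p = y"
    and vis_fv: "0 < found \<Longrightarrow> vis fv = z"
    and mate_fv: "0 < found \<Longrightarrow> mate fv = 0"
    and vis_le: "vis v \<le> z"
    and vis_X: "v \<in> X \<Longrightarrow> vis v = z"
begin

text \<open>No clause enters the queue twice. This limits a search to \<open>m\<close> expansions
  and an augmentation to fewer than \<open>m\<close> flips before the root.\<close>

lemma length_le: "t \<le> m"
proof -
  have "card (Q ` {..<t}) \<le> card {..<m}"
    using Q_less by (intro card_mono) auto
  then show ?thesis
    using inj_Q by (simp add: card_image)
qed

lemma visit_old: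
  assumes "\<not> vis v < z"
  shows "search m N mate match u z vis par Q t found fv (insert v X)"
proof -
  have "vis v = z"
    using assms vis_le[of v] by simp
  show ?thesis
  proof unfold_locales
    show "vis w = z" if "w \<in> insert v X" for w
      using that \<open>vis v = z\<close> vis_X by blast
  qed (fact root nonempty Q_0 inj_Q Q_less vis_match Q_matched par_match par_less mem_par
      free_found mate_queued vis_fv mate_fv vis_le)+
qed

text \<open>A free vertex does not end the search; a later one simply replaces it as the end of the
  path.\<close>

lemma visit_free:
  assumes "vis v < z" "h < t" "v \<in> N (Q h)" "mate v = 0"
  shows "search m N mate match u z (vis(v := z)) (par(v := h)) Q t (Suc 0) v (insert v X)"
proof -
  have "match (Q p) \<noteq> v" if "0 < p" "p < t" for p
    using vis_match[OF that] assms(1) by auto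
  then show ?thesis
    using root nonempty Q_0 inj_Q Q_less vis_match Q_matched par_match par_less mem_par
      mate_queued vis_le vis_X assms
    by unfold_locales (auto split: if_splits)
qed

lemma visit_matched:
  assumes v: "vis v < z" and h: "h < t" "v \<in> N (Q h)" and y: "mate v = Suc y"
  shows "search m N mate match u z (vis(v := z)) (par(v := h)) (Q(t := y)) (Suc t) found fv
    (insert v X)"
proof -
  have y': "y < m" "match y = v" "y \<in> matched mate"
    using y mate_less match_mate matchedI by blast+
  have old: "match (Q p) \<noteq> v" if "0 < p" "p < t" for p
    using vis_match[OF that] v by auto
  \<comment> \<open>A queue entry is either the unmatched root or the owner of a vertex visited
    before, whereas \<open>y\<close> owns the unvisited \<open>v\<close>.\<close>
  have new: "y \<noteq> Q p" if "p < t" for p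
    using old[of p] y' Q_0 root that by (cases "p = 0") auto
  have inj: "inj_on (Q(t := y)) {..<Suc t}"
    using inj_Q new by (auto simp: lessThan_Suc intro!: inj_on_fun_updI)
  have fv: "fv \<noteq> v" if "0 < found"
    using mate_fv[OF that] y by auto
  show ?thesis
  proof unfold_locales
    fix w x assume "(vis(v := z)) w = z" "mate w = Suc x"
    then have "x = y \<or> (\<exists>p. 0 < p \<and> p < t \<and> Q p = x)"
      using mate_queued y by (auto split: if_splits)
    then show "\<exists>p. 0 < p \<and> p < Suc t \<and> (Q(t := y)) p = x"
    proof
      assume "x = y"
      then show ?thesis
        using nonempty by (intro exI[of _ t]) simp
    next
      assume "\<exists>p. 0 < p \<and> p < t \<and> Q p = x"
      then obtain p where "0 < p" "p < t" "Q p = x"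
        by blast
      then show ?thesis
        by (intro exI[of _ p]) simp
    qed
  next
    fix w assume w: "(vis(v := z)) w = z"
    show "(par(v := h)) w < Suc t"
      using par_less[of w] w h by (auto split: if_splits)
    show "w \<in> N ((Q(t := y)) ((par(v := h)) w))"
      using par_less[of w] mem_par[of w] w h by (auto split: if_splits)
    show "0 < found" if "mate w = 0"
      using w free_found that y by (auto split: if_splits)
  next
    fix p assume "0 < p" "p < Suc t"
    then consider "p = t" | "0 < p" "p < t"
      by linarith
    then show "(vis(v := z)) (match ((Q(t := y)) p)) = z" "(Q(t := y)) p \<in> matched mate"
      "(par(v := h)) (match ((Q(t := y)) p)) < p"
      using y' h vis_match Q_matched par_match old by (cases; auto)+
  qed (use root nonempty Q_0 inj Q_less vis_fv fv mate_fv vis_le vis_X y' in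
      \<open>auto simp: less_Suc_eq\<close>)
qed

text \<open>All neighbours of the \<open>t\<close> queued clauses have been visited and none is
  free, so each is the partner of a queue entry other than the root. This leaves at most
  \<open>t - 1\<close> neighbours.\<close>

lemma not_saturable:
  assumes "found = 0" "X = (\<Union>p<t. N (Q p))"
  shows "\<not> saturable m N"
proof (rule not_saturable_if_few_neighbours)
  show "(\<Union>p<t. N (Q p)) \<subseteq> (match \<circ> Q) ` {1..<t}"
  proof
    fix v assume "v \<in> (\<Union>p<t. N (Q p))"
    then have v: "vis v = z"
      using vis_X assms(2) by blast
    then have "mate v \<noteq> 0"
      using free_found assms(1) by blast
    then obtain y where y: "mate v = Suc y"
      using not0_implies_Suc by blast
    then obtain p where "0 < p" "p < t" "Q p = y"
      using mate_queued v by blast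
    then show "v \<in> (match \<circ> Q) ` {1..<t}"
      using match_mate[OF y] by (auto intro!: image_eqI[of _ _ p])
  qed
qed (fact inj_Q Q_less nonempty)+

end

text \<open>A fresh stamp above all earlier ones makes every vertex unvisited without touching
  \<open>vis\<close>; clearing that array would cost time for the copies.\<close>

lemma search_init:
  assumes "matching m N mate match" "u \<notin> matched mate" "\<And>v. vis v < z" "u < m"
  shows "search m N mate match u z vis par (Q(0 := u)) (Suc 0) 0 fv {}"
proof -
  interpret matching m N mate match by fact
  have "vis v \<noteq> z" "vis v \<le> z" for v
    using assms(3)[of v] by auto
  then show ?thesis
    using assms(2,4) by unfold_locales (auto simp: inj_on_def)
qed

text \<open>
  Invariant of flipping the augmenting path from its end: all vertices of \<open>S\<close> are matched without
  the use of \<open>v\<close>, which is about to be assigned to \<open>Q p\<close>.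
\<close>

locale flipping = matching m N "mate(v := 0)" match
  for m N mate v match +
  fixes S :: "nat set" and par Q :: "nat \<Rightarrow> nat" and p :: nat
  assumes matched_eq: "matched (mate(v := 0)) = S"
    and hole: "v \<in> N (Q p)"
    and inj_Q: "inj_on Q {..p}"
    and Q_less: "q \<le> p \<Longrightarrow> Q q < m"
    and match_neq: "0 < q \<Longrightarrow> q \<le> p \<Longrightarrow> match (Q q) \<noteq> v"
    and mate_match_Q: "0 < q \<Longrightarrow> q \<le> p \<Longrightarrow> mate (match (Q q)) = Suc (Q q)"
    and par_match: "0 < q \<Longrightarrow> q \<le> p \<Longrightarrow> par (match (Q q)) < q"
    and mem_par: "0 < q \<Longrightarrow> q \<le> p \<Longrightarrow> match (Q q) \<in> N (Q (par (match (Q q))))"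
begin

text \<open>The hole moves from \<open>v\<close> to the former partner of \<open>Q p\<close>. The
  cell of the new hole still holds its previous owner; the update \<open>mate(v := 0)\<close> in the
  locale masks this stale entry until it is overwritten.\<close>

lemma flip:
  assumes "0 < p"
  shows "flipping m N (mate(v := Suc (Q p))) (match (Q p)) (match(Q p := v)) S par Q
    (par (match (Q p)))"
proof -
  define x w where "x = Q p" and "w = match x"
  have w: "w \<noteq> v" "mate w = Suc x" "par w < p" "w \<in> N (Q (par w))"
    using assms match_neq mate_match_Q par_match mem_par by (auto simp: w_def x_def)
  have A: "y < m" "b \<in> N y" "match y = b" if "mate b = Suc y" "b \<noteq> v" for b y
    using that mate_less[of b y] mate_mem[of b y] match_mate[of b y] by auto
  interpret new: matching m N "(mate(v := Suc x))(w := 0)" "match(x := v)"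
  proof unfold_locales
    fix b y assume "((mate(v := Suc x))(w := 0)) b = Suc y"
    then have "b = v \<and> y = x \<or> b \<noteq> v \<and> b \<noteq> w \<and> mate b = Suc y"
      by (auto split: if_splits)
    then show "y < m" "b \<in> N y" "(match(x := v)) y = b"
      using A[of b y] hole Q_less[of p] by (auto simp: x_def w_def)
  qed
  have "y \<in> matched ((mate(v := Suc x))(w := 0)) \<longleftrightarrow> y \<in> matched (mate(v := 0))" for y
    unfolding mem_matched_update using w(1,2) by (metis fun_upd_apply nat.distinct(1) old.nat.inject)
  then have "matched ((mate(v := Suc x))(w := 0)) = S"
    using matched_eq by blast
  moreover have "inj_on Q {..par w}"
    using inj_Q by (rule inj_on_subset) (use w(3) in auto)
  moreover have "Q q \<noteq> x" if "q \<le> par w" for q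
    using inj_onD[OF inj_Q, of q p] that w(3) by (auto simp: x_def)
  moreover have "match (Q q) \<noteq> w" if "q \<le> par w" "0 < q" for q
    using calculation(3)[OF that(1)] mate_match_Q[of q] that w(2,3) by auto
  ultimately have "flipping m N (mate(v := Suc x)) w (match(x := v)) S par Q (par w)"
    using w Q_less match_neq mate_match_Q par_match mem_par
    by unfold_locales auto
  then show ?thesis
    by (simp add: w_def x_def)
qed

text \<open>Only here does the matching grow: the root takes the last hole without leaving another
  one behind.\<close>

lemma flip_root:
  assumes "p = 0" "Q 0 \<notin> S"
  shows "matching m N (mate(v := Suc (Q 0))) (match(Q 0 := v))"
    and "matched (mate(v := Suc (Q 0))) = insert (Q 0) S"
proof -
  have A: "y < m \<and> b \<in> N y \<and> match y = b \<and> y \<noteq> Q 0" if "mate b = Suc y" "b \<noteq> v" for b y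
    using that mate_less[of b y] mate_mem[of b y] match_mate[of b y] assms(2) matched_eq
    by (auto simp: matched_def)
  show "matching m N (mate(v := Suc (Q 0))) (match(Q 0 := v))"
    by unfold_locales (use A hole Q_less assms(1) in \<open>auto split: if_splits\<close>)
  show "matched (mate(v := Suc (Q 0))) = insert (Q 0) S"
    unfolding matched_eq[symmetric] set_eq_iff insert_iff mem_matched_update by auto
qed

end

lemma (in search) flipping_init:
  assumes "0 < found"
  shows "flipping m N mate fv match (matched mate) par Q (par fv)"
proof -
  have fv: "vis fv = z" "mate fv = 0" "par fv < t"
    using assms vis_fv mate_fv par_less by auto
  then have eq: "mate(fv := 0) = mate"
    by auto
  have "inj_on Q {..par fv}"
    using inj_Q by (rule inj_on_subset) (use fv(3) in auto)
  moreover have "match (Q q) \<noteq> fv" if "0 < q" "q < t" for q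
    using mate_match[OF Q_matched[OF that]] fv(2) by auto
  ultimately show ?thesis
    using fv mem_par Q_less mate_match Q_matched par_match vis_match
    by (unfold_locales; (unfold eq)?) (auto simp: mate_less mate_mem match_mate)
qed

section \<open>Monomials and matchings\<close>

lemma lookup_sum_var_mon: "Poly_Mapping.lookup (sum_list (map var_mon xs)) i = count_list xs i"
  by (induction xs) (simp_all add: var_mon_def lookup_add lookup_single when_def)

text \<open>The exponent of a variable that occurs is positive anyway, and \<open>0 < c\<close>
  supplies the bound for one that does not, so the test can range over all variables.\<close>

lemma has_c_monomial_iff_count:
  assumes "0 < c"
  shows "has_c_monomial c F \<longleftrightarrow>
    (\<exists>xs. list_all2 (\<lambda>x C. x \<in> set C) xs F \<and> (\<forall>x. count_list xs x < c))"
proof -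
  have "is_c_monomial c (sum_list (map var_mon xs)) \<longleftrightarrow> (\<forall>x. count_list xs x < c)" for xs
    unfolding is_c_monomial_def Ball_def in_keys_iff lookup_sum_var_mon using assms
    by (metis less_one not_le_imp_less)
  then show ?thesis
    by (auto simp: has_c_monomial_def expansion_monomials_def)
qed

lemma count_list_conv_card: "count_list xs x = card {i. i < length xs \<and> xs ! i = x}"
  by (simp add: count_list_eq_length_filter length_filter_conv_card eq_commute)

text \<open>The multiples of \<open>Suc n\<close> keep the copies of the variables, which are at most \<open>n\<close>, apart.\<close>

definition copies :: "nat \<Rightarrow> nat \<Rightarrow> nat list \<Rightarrow> nat set" where
  "copies n d C = (\<Union>x\<in>set C. (\<lambda>j. x + j * Suc n) ` {..<d})"

text \<open>Clauses that choose the same variable take different copies of it, and \<open>d\<close>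
  copies suffice for \<open>d\<close> such clauses. Conversely, the residue modulo
  \<open>Suc n\<close> recovers the variable of a copy.\<close>

lemma has_c_monomial_iff_saturable:
  assumes "is_pi_sigma n m s F"
  shows "has_c_monomial (Suc d) F \<longleftrightarrow> saturable m (\<lambda>i. copies n d (F ! i))"
proof -
  have len: "length F = m" and vars: "\<And>i x. i < m \<Longrightarrow> x \<in> set (F ! i) \<Longrightarrow> x \<le> n"
    using assms unfolding is_pi_sigma_def by (metis, metis atLeastAtMost_iff nth_mem subsetD)
  have "saturable m (\<lambda>i. copies n d (F ! i))"
    if xs: "list_all2 (\<lambda>x C. x \<in> set C) xs F" "\<And>x. count_list xs x < Suc d" for xs
  proof -
    have xs': "length xs = m" "\<And>i. i < m \<Longrightarrow> xs ! i \<in> set (F ! i)"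
      using xs(1) len by (auto simp: list_all2_conv_all_nth)
    \<comment> \<open>The clauses before \<open>i\<close> with the same choice: their number tells
      which copy of the variable \<open>i\<close> takes.\<close>
    define R where "R i = {k. k < i \<and> xs ! k = xs ! i}" for i
    define f where "f i = xs ! i + card (R i) * Suc n" for i
    have mod: "f i mod Suc n = xs ! i" and div: "f i div Suc n = card (R i)" if "i < m" for i
      using vars[OF that xs'(2)[OF that]] unfolding f_def
      by (simp_all del: mult_Suc_right)
    have less: "card (R i) < card (R k)" if "xs ! i = xs ! k" "i < k" for i k
    proof (rule psubset_card_mono)
      have "i \<in> R k - R i"
        using that by (simp add: R_def)
      moreover have "R i \<subseteq> R k"
        using that by (auto simp: R_def)
      ultimately show "R i \<subset> R k"
        by blast
    qed (simp add: R_def)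
    have "f i \<in> copies n d (F ! i)" if "i < m" for i
    proof -
      have "card (R i) < card {k. k < m \<and> xs ! k = xs ! i}"
        by (rule psubset_card_mono) (use that in \<open>auto simp: R_def\<close>)
      also have "\<dots> \<le> d"
        using xs(2)[of "xs ! i"] xs'(1) by (simp add: count_list_conv_card)
      finally show ?thesis
        using xs'(2)[OF that] by (auto simp: copies_def f_def)
    qed
    moreover have "inj_on f {..<m}"
    proof (rule inj_onI)
      fix i k assume "i \<in> {..<m}" "k \<in> {..<m}" "f i = f k"
      then have "xs ! i = xs ! k" "card (R i) = card (R k)"
        using mod div by (metis lessThan_iff)+
      then show "i = k"
        using less[of i k] less[of k i] by (cases i k rule: linorder_cases) auto
    qed
    ultimately show ?thesis
      by (auto simp: saturable_def)
  qed
  moreover have "\<exists>xs. list_all2 (\<lambda>x C. x \<in> set C) xs F \<and> (\<forall>x. count_list xs x < Suc d)"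
    if "inj_on f {..<m}" and f: "\<And>i. i < m \<Longrightarrow> f i \<in> copies n d (F ! i)" for f
  proof (intro exI conjI allI)
    let ?xs = "map (\<lambda>i. f i mod Suc n) [0..<m]"
    have eq: "f i mod Suc n \<in> set (F ! i) \<and> (\<exists>j<d. f i = f i mod Suc n + j * Suc n)"
      if i: "i < m" for i
    proof -
      obtain x j where x: "x \<in> set (F ! i)" "j < d" "f i = x + j * Suc n"
        using f[OF i] by (auto simp: copies_def)
      then have "f i mod Suc n = x"
        using vars[OF i x(1)] by (simp del: mult_Suc_right)
      then show ?thesis
        using x by auto
    qed
    then show "list_all2 (\<lambda>x C. x \<in> set C) ?xs F"
      by (simp add: list_all2_conv_all_nth len)
    fix x
    let ?I = "{i. i < m \<and> f i mod Suc n = x}"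
    have "card ?I = card (f ` ?I)"
      using that(1) by (intro card_image[symmetric]) (auto intro: inj_on_subset)
    also have "\<dots> \<le> card ((\<lambda>j. x + j * Suc n) ` {..<d})"
      using eq by (intro card_mono) auto
    also have "\<dots> \<le> d"
      using card_image_le[of "{..<d}"] by simp
    finally show "count_list ?xs x < Suc d"
      by (simp add: count_list_conv_card cong: conj_cong)
  qed
  ultimately show ?thesis
    unfolding has_c_monomial_iff_count[of "Suc d" F, simplified] by (auto simp: saturable_def)
qed

lemma saturable_cong: "(\<And>i. i < m \<Longrightarrow> N i = N' i) \<Longrightarrow> saturable m N = saturable m N'"
  by (simp add: saturable_def)

section \<open>The auction\<close>

notation Seq (infixr ";;" 60)

abbreviation reg :: "nat \<Rightarrow> expr" where
  "reg r \<equiv> Cell r (Const 0)"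

abbreviation put :: "nat \<Rightarrow> expr \<Rightarrow> prog" where
  "put r e \<equiv> Assign r (Const 0) e"

abbreviation inc :: "nat \<Rightarrow> prog" where
  "inc r \<equiv> put r (Add (reg r) (Const 1))"

text \<open>
  Every register is an array of its own that is used at index 0 only, so that \<^const>\<open>agree_off\<close>
  tells which registers a program leaves alone.
\<close>

abbreviation (input) "startA \<equiv> 2 :: nat"
abbreviation (input) "edgeA \<equiv> 3 :: nat"
abbreviation (input) "priceA \<equiv> 4 :: nat"
abbreviation (input) "mateA \<equiv> 5 :: nat"
abbreviation (input) "matchA \<equiv> 6 :: nat"
abbreviation (input) "giveA \<equiv> 7 :: nat"
abbreviation (input) "queueA \<equiv> 8 :: nat"
abbreviation (input) "visA \<equiv> 9 :: nat"
abbreviation (input) "parA \<equiv> 10 :: nat"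
abbreviation (input) "posR \<equiv> 11 :: nat"
abbreviation (input) "stopR \<equiv> 12 :: nat"
abbreviation (input) "clauseR \<equiv> 13 :: nat"
abbreviation (input) "copyR \<equiv> 14 :: nat"
abbreviation (input) "countR \<equiv> 15 :: nat"
abbreviation (input) "squareR \<equiv> 17 :: nat"
abbreviation (input) "limitR \<equiv> 18 :: nat"
abbreviation (input) "edgeR \<equiv> 19 :: nat"
abbreviation (input) "lastR \<equiv> 20 :: nat"
abbreviation (input) "rightR \<equiv> 21 :: nat"
abbreviation (input) "bestR \<equiv> 22 :: nat"
abbreviation (input) "bidR \<equiv> 23 :: nat"
abbreviation (input) "oldR \<equiv> 24 :: nat"
abbreviation (input) "leftR \<equiv> 25 :: nat"
abbreviation (input) "nextR \<equiv> 26 :: nat"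
abbreviation (input) "giveR \<equiv> 27 :: nat"
abbreviation (input) "stampR \<equiv> 28 :: nat"
abbreviation (input) "headR \<equiv> 29 :: nat"
abbreviation (input) "tailR \<equiv> 30 :: nat"
abbreviation (input) "foundR \<equiv> 31 :: nat"
abbreviation (input) "freeR \<equiv> 32 :: nat"
abbreviation (input) "pathR \<equiv> 33 :: nat"

definition compare_edge :: prog where
  "compare_edge =
     put rightR (Cell edgeA (reg edgeR)) ;;
     Cond (Less (Cell priceA (reg rightR)) (reg bestR))
       (put bestR (Cell priceA (reg rightR)) ;; put bidR (reg rightR)) Skip ;;
     inc edgeR"

text \<open>\<open>bestR\<close> starts at the limit and comparisons are strict, so it ends below
  the limit exactly if some copy is affordable. Only then is \<open>bidR\<close> meaningful.\<close>

definition scan :: prog where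
  "scan =
     (put bestR (reg limitR) ;; put edgeR (Cell startA (reg leftR)) ;;
      put lastR (Cell startA (Add (reg leftR) (Const 1)))) ;;
     While (Less (reg edgeR) (reg lastR)) compare_edge"

definition advance :: prog where
  "advance = inc nextR ;; put leftR (reg nextR)"

text \<open>An evicted owner is treated at once, so at most one displaced clause is pending and no
  work list is required.\<close>

definition settle :: prog where
  "settle =
     Cond (Less (reg bestR) (reg limitR))
       (put oldR (Cell mateA (reg bidR)) ;;
        Assign mateA (reg bidR) (Add (reg leftR) (Const 1)) ;;
        Assign matchA (reg leftR) (reg bidR) ;;
        Assign priceA (reg bidR) (Add (reg bestR) (Const 1)) ;;
        Cond (Less (Const 0) (reg oldR)) (put leftR (Sub (reg oldR) (Const 1))) advance)
       (Assign giveA (reg giveR) (reg leftR) ;; inc giveR ;; advance)"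

definition auction :: prog where
  "auction = While (Less (reg leftR) (Cell 0 (Const 1))) (scan ;; settle)"

text \<open>Adjacency lists in compressed row form; \<open>D\<close> bounds the degree of a clause
  and thereby the cost of one scan.\<close>

locale layout =
  fixes m D :: nat and st ed :: "nat \<Rightarrow> nat"
  assumes st_mono: "u < m \<Longrightarrow> st u \<le> st (Suc u)"
    and st_bound: "u < m \<Longrightarrow> st (Suc u) \<le> st u + D"
begin

definition N :: "nat \<Rightarrow> nat set" where
  "N u = ed ` {st u..<st (Suc u)}"

definition stored :: "store \<Rightarrow> bool" where
  "stored \<sigma> \<longleftrightarrow> \<sigma> 0 1 = m \<and> \<sigma> startA = st \<and> \<sigma> edgeA = ed"

lemma stored_agree_off:
  "stored \<sigma> \<Longrightarrow> agree_off A \<sigma> \<tau> \<Longrightarrow> A \<inter> {0, startA, edgeA} = {} \<Longrightarrow> stored \<tau>"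
  by (simp add: stored_def agree_off_def)

lemma exec_scan:
  assumes "stored \<sigma>" "\<sigma> leftR 0 = u" "u < m" "\<sigma> limitR 0 = L"
  shows "exec scan \<sigma> (50 * D + 50) (\<lambda>\<tau>. \<tau> bestR 0 \<le> L \<and>
    (\<forall>w\<in>N u. \<tau> bestR 0 \<le> \<sigma> priceA w) \<and>
    (\<tau> bestR 0 < L \<longrightarrow> \<tau> bidR 0 \<in> N u \<and> \<sigma> priceA (\<tau> bidR 0) = \<tau> bestR 0))"
proof -
  define I where "I = (\<lambda>\<tau> :: store. st u \<le> \<tau> edgeR 0 \<and> \<tau> edgeR 0 \<le> st (Suc u) \<and>
    \<tau> lastR 0 = st (Suc u) \<and> \<tau> bestR 0 \<le> L \<and>
    (\<forall>w\<in>ed ` {st u..<\<tau> edgeR 0}. \<tau> bestR 0 \<le> \<sigma> priceA w) \<and>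
    (\<tau> bestR 0 < L \<longrightarrow> \<tau> bidR 0 \<in> N u \<and> \<sigma> priceA (\<tau> bidR 0) = \<tau> bestR 0))"
  let ?pre = "put bestR (reg limitR) ;; put edgeR (Cell startA (reg leftR)) ;;
      put lastR (Cell startA (Add (reg leftR) (Const 1)))"
  let ?t = "Less (reg edgeR) (reg lastR)"
  let ?f = "\<lambda>\<tau> :: store. st (Suc u) - \<tau> edgeR 0"
  let ?\<sigma> = "effect ?pre \<sigma>"
  have init: "I ?\<sigma>"
    using assms st_mono[of u] by (simp add: I_def stored_def)
  have step: "exec compare_edge \<rho> 40 (\<lambda>\<tau>. I \<tau> \<and> ?f \<tau> < ?f \<rho>)"
    if I: "I \<rho>" and fr: "agree_off (writes compare_edge) ?\<sigma> \<rho>" and t: "test_val ?t \<rho>" for \<rho>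
  proof (intro exec_step conjI)
    have *: "\<rho> edgeA = ed" "\<rho> priceA = \<sigma> priceA"
      using assms by (simp_all add: agree_offD[OF fr] compare_edge_def stored_def)
    have lt: "\<rho> edgeR 0 < st (Suc u)" and le: "st u \<le> \<rho> edgeR 0"
      using t I by (simp_all add: I_def)
    have "{st u..<Suc (\<rho> edgeR 0)} = insert (\<rho> edgeR 0) {st u..<\<rho> edgeR 0}"
      using le by auto
    moreover have "ed (\<rho> edgeR 0) \<in> N u"
      using lt le by (simp add: N_def)
    ultimately show "I (effect compare_edge \<rho>)"
      using I lt * by (auto simp: I_def compare_edge_def)
    show "?f (effect compare_edge \<rho>) < ?f \<rho>"
      using lt by (simp add: compare_edge_def)
  qed (simp_all add: compare_edge_def)
  show ?thesis
    unfolding scan_def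
  proof (rule exec_mono[OF exec_Seq_step[OF _ exec_While[of I, OF init step]]])
    show "max_cost ?pre + (?f ?\<sigma> * (1 + test_cost ?t + 40) + (1 + test_cost ?t)) \<le> 50 * D + 50"
      using st_bound[OF assms(3)] assms by (simp add: stored_def)
  qed (auto simp: I_def N_def)
qed

lemma exec_auction:
  assumes "stored \<sigma>" "\<sigma> limitR 0 = L" "\<sigma> priceA = (\<lambda>_. 0)" "\<sigma> mateA = (\<lambda>_. 0)"
    and "\<sigma> giveR 0 = 0" "\<sigma> leftR 0 = 0" "\<sigma> nextR 0 = 0"
  shows "exec auction \<sigma> (200 * (D + 1) * (m * L + m + 1)) (\<lambda>\<tau>.
    market m N (\<tau> mateA) (\<tau> matchA) L (\<tau> priceA) (\<tau> giveA) (\<tau> giveR 0) {})"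
proof -
  define U where "U = (\<Union>u<m. N u)"
  have fin: "finite U"
    by (simp add: U_def N_def)
  define mk where "mk = (\<lambda>\<tau> :: store.
    market m N (\<tau> mateA) (\<tau> matchA) L (\<tau> priceA) (\<tau> giveA) (\<tau> giveR 0))"
  \<comment> \<open>Pending are the current clause and those beyond \<open>nextR\<close>. As the
    former is not among the latter, removing it leaves exactly the latter. A value of
    \<open>leftR\<close> not below \<open>m\<close> says that nothing is pending.\<close>
  define I where "I = (\<lambda>\<tau> :: store. if \<tau> leftR 0 < m
    then \<tau> nextR 0 < m \<and> \<tau> leftR 0 \<notin> {Suc (\<tau> nextR 0)..<m} \<and>
      mk \<tau> (insert (\<tau> leftR 0) {Suc (\<tau> nextR 0)..<m})
    else mk \<tau> {})"
  let ?t = "Less (reg leftR) (Cell 0 (Const 1))"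
  \<comment> \<open>A bid lowers the first summand, giving up lowers the second, and neither raises
    the other.\<close>
  let ?f = "\<lambda>\<tau> :: store. (m * L - (\<Sum>v\<in>U. \<tau> priceA v)) + (m - \<tau> nextR 0)"
  have init: "I \<sigma>"
  proof (cases "0 < m")
    case True
    then have "insert 0 {Suc 0..<m} = {..<m}"
      by auto
    then show ?thesis
      using assms True market_init by (auto simp: I_def mk_def)
  qed (use assms market_init[of 0] in \<open>simp add: I_def mk_def\<close>)
  have step: "exec (scan ;; settle) \<rho> (50 * D + 150) (\<lambda>\<tau>. I \<tau> \<and> ?f \<tau> < ?f \<rho>)"
    if I: "I \<rho>" and fr: "agree_off (writes (scan ;; settle)) \<sigma> \<rho>" and t: "test_val ?t \<rho>" for \<rho>
  proof -
    define u i where "u = \<rho> leftR 0" and "i = \<rho> nextR 0"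
    have st: "stored \<rho>"
      using stored_agree_off[OF assms(1) fr]
      by (simp add: scan_def settle_def compare_edge_def advance_def)
    have L: "\<rho> limitR 0 = L"
      using assms by (simp add: agree_offD[OF fr] scan_def settle_def compare_edge_def advance_def)
    have u: "u < m" and i: "i < m" "u \<notin> {Suc i..<m}" and M: "mk \<rho> (insert u {Suc i..<m})"
      using t I st by (simp_all add: I_def u_def i_def stored_def)
    interpret M: market m N "\<rho> mateA" "\<rho> matchA" L "\<rho> priceA" "\<rho> giveA" "\<rho> giveR 0"
      "insert u {Suc i..<m}"
      using M by (simp add: mk_def)
    have rest: "\<not> Suc i < m \<Longrightarrow> {Suc i..<m} = {}"
      "Suc i < m \<Longrightarrow> {Suc i..<m} = insert (Suc i) {Suc (Suc i)..<m}"
      by auto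
    have T: "insert u {Suc i..<m} - {u} = {Suc i..<m}"
      using i by auto
    show ?thesis
    proof (rule exec_mono[OF exec_Seq[OF exec_scan[OF st u_def[symmetric] u L]
            exec_step[where T = 90]]])
      fix \<tau>
      assume post: "\<tau> bestR 0 \<le> L \<and> (\<forall>w\<in>N u. \<tau> bestR 0 \<le> \<rho> priceA w) \<and>
        (\<tau> bestR 0 < L \<longrightarrow> \<tau> bidR 0 \<in> N u \<and> \<rho> priceA (\<tau> bidR 0) = \<tau> bestR 0)"
        and fr: "agree_off (writes scan) \<rho> \<tau>"
      have same: "\<tau> mateA = \<rho> mateA" "\<tau> matchA = \<rho> matchA" "\<tau> priceA = \<rho> priceA"
        "\<tau> giveA = \<rho> giveA" "\<tau> giveR = \<rho> giveR" "\<tau> leftR 0 = u" "\<tau> nextR 0 = i" "\<tau> limitR 0 = L"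
        using L by (simp_all add: agree_offD[OF fr] scan_def compare_edge_def u_def i_def)
      show "I (effect settle \<tau>) \<and> ?f (effect settle \<tau>) < ?f \<rho>"
      proof (cases "\<tau> bestR 0 < L")
        case True
        define v where "v = \<tau> bidR 0"
        have v: "v \<in> N u" "\<rho> priceA v = \<tau> bestR 0"
          using post True by (simp_all add: v_def)
        let ?price = "(\<rho> priceA)(v := Suc (\<rho> priceA v))"
        interpret M': market m N "(\<rho> mateA)(v := Suc u)" "(\<rho> matchA)(u := v)" L ?price
          "\<rho> giveA" "\<rho> giveR 0" "{Suc i..<m} \<union> {y. \<rho> mateA v = Suc y}"
          using M.bid[of u v] v post True unfolding T by simp
        have "v \<in> U"
          using u v(1) by (auto simp: U_def)
        then have "sum ?price U = Suc (sum (\<rho> priceA) U)"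
          using fin by (simp add: sum.remove)
        \<comment> \<open>The price bound is applied after the bid; it guarantees that truncated
          subtraction does not swallow the increase.\<close>
        then have sum: "m * L - sum ?price U < m * L - sum (\<rho> priceA) U"
          using M'.sum_price_le[OF fin] by linarith
        show ?thesis
        proof (cases "\<rho> mateA v")
          case 0
          have "I (effect settle \<tau>)"
            using True 0 v M'.market_axioms
            by (auto simp: I_def mk_def settle_def advance_def same v_def[symmetric] rest)
          then show ?thesis
            using sum v True 0
            by (auto simp: settle_def advance_def same v_def[symmetric] i_def)
        next
          case (Suc y)
          then have "y < m" "y \<notin> {Suc i..<m}"
            using M.mate_less[OF Suc] M.todo_unmatched[of y] matchedI[of "\<rho> mateA", OF Suc] by auto
          then show ?thesis
            using True Suc v i M'.market_axioms sum
            by (auto simp: I_def mk_def settle_def advance_def same v_def[symmetric] i_def)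
        qed
      next
        case False
        then have "\<tau> bestR 0 = L"
          using post by simp
        then have "mk (effect settle \<tau>) {Suc i..<m}"
          using M.give_up[of u] post unfolding T
          by (simp add: mk_def settle_def advance_def same)
        then show ?thesis
          using False i by (auto simp: I_def settle_def advance_def same i_def[symmetric] rest)
      qed
    qed (simp_all add: settle_def advance_def)
  qed
  show ?thesis
    unfolding auction_def
  proof (rule exec_mono[OF exec_While[of I, OF init step]])
    have "?f \<sigma> = m * L + m"
      using assms by simp
    then have "?f \<sigma> * (1 + test_cost ?t + (50 * D + 150)) + (1 + test_cost ?t) =
        (m * L + m) * (50 * D + 156) + 6"
      by (simp add: algebra_simps)
    also have "\<dots> \<le> (m * L + m) * (200 * (D + 1)) + 200 * (D + 1)"
      by (intro add_mono mult_left_mono) simp_all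
    also have "\<dots> = 200 * (D + 1) * (m * L + m + 1)"
      by (simp add: algebra_simps)
    finally show "?f \<sigma> * (1 + test_cost ?t + (50 * D + 150)) + (1 + test_cost ?t)
        \<le> 200 * (D + 1) * (m * L + m + 1)" .
    fix \<tau>
    assume "I \<tau> \<and> \<not> test_val ?t \<tau>" and fr: "agree_off (writes (While ?t (scan ;; settle))) \<sigma> \<tau>"
    then show "market m N (\<tau> mateA) (\<tau> matchA) L (\<tau> priceA) (\<tau> giveA) (\<tau> giveR 0) {}"
      using stored_agree_off[OF assms(1) fr]
      by (auto simp: I_def mk_def stored_def scan_def settle_def compare_edge_def advance_def)
  qed
qed

end

section \<open>Augmenting paths\<close>

definition visit :: prog where
  "visit =
     put rightR (Cell edgeA (reg edgeR)) ;;
     Cond (Less (Cell visA (reg rightR)) (reg stampR))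
       (Assign visA (reg rightR) (reg stampR) ;;
        Assign parA (reg rightR) (reg headR) ;;
        Cond (Less (Const 0) (Cell mateA (reg rightR)))
          (Assign queueA (reg tailR) (Sub (Cell mateA (reg rightR)) (Const 1)) ;; inc tailR)
          (put foundR (Const 1) ;; put freeR (reg rightR)))
       Skip ;;
     inc edgeR"

definition explore :: prog where
  "explore =
     (put edgeR (Cell startA (Cell queueA (reg headR))) ;;
      put lastR (Cell startA (Add (Cell queueA (reg headR)) (Const 1)))) ;;
     While (Less (reg edgeR) (reg lastR)) visit ;;
     inc headR"

text \<open>
  The stamp counts the searches: before it is incremented it is also the index of the given-up
  clause at which the next search starts.
\<close>

definition bfs :: prog where
  "bfs =
     (Assign queueA (Const 0) (Cell giveA (reg stampR)) ;;
      inc stampR ;; put headR (Const 0) ;; put tailR (Const 1) ;; put foundR (Const 0)) ;;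
     While (Less (reg headR) (reg tailR)) explore"

definition flip_edge :: prog where
  "flip_edge =
     put leftR (Cell queueA (reg pathR)) ;;
     put rightR (Cell matchA (reg leftR)) ;;
     Assign matchA (reg leftR) (reg freeR) ;;
     Assign mateA (reg freeR) (Add (reg leftR) (Const 1)) ;;
     put freeR (reg rightR) ;;
     put pathR (Cell parA (reg freeR))"

definition augment :: prog where
  "augment =
     put pathR (Cell parA (reg freeR)) ;;
     While (Less (Const 0) (reg pathR)) flip_edge ;;
     (put leftR (Cell queueA (Const 0)) ;;
      Assign matchA (reg leftR) (reg freeR) ;;
      Assign mateA (reg freeR) (Add (reg leftR) (Const 1)))"

text \<open>Array 1 holds the answer and doubles as the loop flag. The initial test keeps the number
  of searches within the limit.\<close>

definition repair :: prog where
  "repair =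
     Cond (Less (reg limitR) (reg giveR)) (put 1 (Const 0)) (put 1 (Const 1)) ;;
     While (Conj (Less (reg stampR) (reg giveR)) (Less (Const 0) (reg 1)))
       (bfs ;; Cond (Less (Const 0) (reg foundR)) augment (put 1 (Const 0)))"

section \<open>Correctness and cost of search and augmentation\<close>

context layout
begin

definition searching :: "nat \<Rightarrow> nat \<Rightarrow> store \<Rightarrow> nat set \<Rightarrow> bool" where
  "searching u z \<sigma> X \<longleftrightarrow> search m N (\<sigma> mateA) (\<sigma> matchA) u z (\<sigma> visA) (\<sigma> parA) (\<sigma> queueA)
     (\<sigma> tailR 0) (\<sigma> foundR 0) (\<sigma> freeR 0) X"

lemma exec_visit:
  assumes S: "searching u z \<sigma> X" and "\<sigma> stampR 0 = z" "\<sigma> headR 0 = h" "h < \<sigma> tailR 0"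
    and "\<sigma> edgeA (\<sigma> edgeR 0) = v" "v \<in> N (\<sigma> queueA h)"
  shows "exec visit \<sigma> 60 (\<lambda>\<tau>. searching u z \<tau> (insert v X) \<and> \<tau> edgeR 0 = Suc (\<sigma> edgeR 0) \<and>
    (\<forall>p\<le>h. \<tau> queueA p = \<sigma> queueA p) \<and> \<sigma> tailR 0 \<le> \<tau> tailR 0)"
proof (rule exec_step)
  interpret search m N "\<sigma> mateA" "\<sigma> matchA" u z "\<sigma> visA" "\<sigma> parA" "\<sigma> queueA" "\<sigma> tailR 0"
    "\<sigma> foundR 0" "\<sigma> freeR 0" X
    using S by (simp add: searching_def)
  consider "\<not> \<sigma> visA v < z" | "\<sigma> visA v < z" "\<sigma> mateA v = 0"
    | y where "\<sigma> visA v < z" "\<sigma> mateA v = Suc y"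
    by (meson not0_implies_Suc)
  then show "searching u z (effect visit \<sigma>) (insert v X) \<and>
      effect visit \<sigma> edgeR 0 = Suc (\<sigma> edgeR 0) \<and>
      (\<forall>p\<le>h. effect visit \<sigma> queueA p = \<sigma> queueA p) \<and> \<sigma> tailR 0 \<le> effect visit \<sigma> tailR 0"
  proof cases
    case 1
    then show ?thesis
      using visit_old assms by (simp add: searching_def visit_def)
  next
    case 2
    then show ?thesis
      using visit_free[OF 2(1) assms(4) _ 2(2)] assms by (simp add: searching_def visit_def)
  next
    case 3
    then show ?thesis
      using visit_matched[OF 3(1) assms(4) _ 3(2)] assms by (auto simp: searching_def visit_def)
  qed
qed (simp_all add: visit_def)

lemma exec_explore:
  assumes S: "searching u z \<sigma> (\<Union>p<h. N (\<sigma> queueA p))" and "stored \<sigma>"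
    and "\<sigma> stampR 0 = z" "\<sigma> headR 0 = h" "h < \<sigma> tailR 0"
  shows "exec explore \<sigma> (80 * D + 80) (\<lambda>\<tau>. \<tau> headR 0 = Suc h \<and> h < \<tau> tailR 0 \<and>
    searching u z \<tau> (\<Union>p<Suc h. N (\<tau> queueA p)))"
proof -
  interpret search m N "\<sigma> mateA" "\<sigma> matchA" u z "\<sigma> visA" "\<sigma> parA" "\<sigma> queueA" "\<sigma> tailR 0"
    "\<sigma> foundR 0" "\<sigma> freeR 0" "\<Union>p<h. N (\<sigma> queueA p)"
    using S by (simp add: searching_def)
  define x where "x = \<sigma> queueA h"
  have x: "x < m"
    using Q_less assms by (simp add: x_def)
  define I where "I = (\<lambda>\<tau> :: store. st x \<le> \<tau> edgeR 0 \<and> \<tau> edgeR 0 \<le> st (Suc x) \<and>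
    \<tau> lastR 0 = st (Suc x) \<and> h < \<tau> tailR 0 \<and> (\<forall>p\<le>h. \<tau> queueA p = \<sigma> queueA p) \<and>
    searching u z \<tau> ((\<Union>p<h. N (\<sigma> queueA p)) \<union> ed ` {st x..<\<tau> edgeR 0}))"
  let ?pre = "put edgeR (Cell startA (Cell queueA (reg headR))) ;;
    put lastR (Cell startA (Add (Cell queueA (reg headR)) (Const 1)))"
  let ?t = "Less (reg edgeR) (reg lastR)"
  let ?f = "\<lambda>\<tau> :: store. st (Suc x) - \<tau> edgeR 0"
  let ?\<sigma> = "effect ?pre \<sigma>"
  have init: "I ?\<sigma>"
    using assms st_mono[OF x] by (simp add: I_def stored_def x_def searching_def)
  have step: "exec visit \<rho> 60 (\<lambda>\<tau>. I \<tau> \<and> ?f \<tau> < ?f \<rho>)"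
    if I: "I \<rho>" and fr: "agree_off (writes visit) ?\<sigma> \<rho>" and t: "test_val ?t \<rho>" for \<rho>
  proof -
    have st: "\<rho> edgeA = ed" "\<rho> stampR 0 = z" "\<rho> headR 0 = h"
      using assms by (simp_all add: agree_offD[OF fr] visit_def stored_def)
    have lt: "st x \<le> \<rho> edgeR 0" "\<rho> edgeR 0 < st (Suc x)"
      using t I by (simp_all add: I_def)
    then have ins: "ed ` {st x..<Suc (\<rho> edgeR 0)} = insert (ed (\<rho> edgeR 0)) (ed ` {st x..<\<rho> edgeR 0})"
      by (simp add: atLeastLessThanSuc)
    have mem: "\<rho> edgeA (\<rho> edgeR 0) \<in> N (\<rho> queueA h)"
      using lt I st by (simp add: N_def I_def x_def[symmetric])
    have S: "searching u z \<rho> ((\<Union>p<h. N (\<sigma> queueA p)) \<union> ed ` {st x..<\<rho> edgeR 0})"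
      and h: "h < \<rho> tailR 0"
      using I by (simp_all add: I_def)
    show ?thesis
      by (rule exec_mono[OF exec_visit[OF S st(2,3) h refl mem]])
        (use I lt in \<open>simp_all add: I_def st ins agree_off_def visit_def diff_less_mono2\<close>)
  qed
  show ?thesis
    unfolding explore_def
  proof (rule exec_mono[OF exec_Seq_step[OF _ exec_Seq[OF exec_While[of I, OF init step]
            exec_step[where T = 10]]]])
    fix \<tau> assume I: "I \<tau> \<and> \<not> test_val ?t \<tau>"
      and fr: "agree_off (writes (While ?t visit)) ?\<sigma> \<tau>"
    have "\<tau> headR 0 = h"
      using assms by (simp add: agree_offD[OF fr] visit_def)
    moreover have "(\<Union>p<Suc h. N (\<tau> queueA p)) = (\<Union>p<h. N (\<sigma> queueA p)) \<union> ed ` {st x..<\<tau> edgeR 0}"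
      using I by (auto simp: I_def lessThan_Suc N_def x_def[symmetric])
    ultimately show "effect (inc headR) \<tau> headR 0 = Suc h \<and> h < effect (inc headR) \<tau> tailR 0 \<and>
        searching u z (effect (inc headR) \<tau>) (\<Union>p<Suc h. N (effect (inc headR) \<tau> queueA p))"
      using I by (simp add: I_def searching_def)
  next
    show "max_cost ?pre + (?f ?\<sigma> * (1 + test_cost ?t + 60) + (1 + test_cost ?t) + 10) \<le> 80 * D + 80"
      using st_bound[OF x] assms by (simp add: stored_def x_def[symmetric])
  qed simp_all
qed

lemma exec_bfs:
  assumes "stored \<sigma>" "matching m N (\<sigma> mateA) (\<sigma> matchA)"
    and "\<sigma> giveA (\<sigma> stampR 0) = u" "u \<notin> matched (\<sigma> mateA)" "u < m"
    and "\<And>v. \<sigma> visA v \<le> \<sigma> stampR 0"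
  shows "exec bfs \<sigma> (100 * (D + 1) * (m + 1)) (\<lambda>\<tau>. \<tau> stampR 0 = Suc (\<sigma> stampR 0) \<and>
    searching u (Suc (\<sigma> stampR 0)) \<tau> (\<Union>p<\<tau> tailR 0. N (\<tau> queueA p)))"
proof -
  define z where "z = Suc (\<sigma> stampR 0)"
  define I where "I = (\<lambda>\<tau> :: store. \<tau> stampR 0 = z \<and> \<tau> headR 0 \<le> \<tau> tailR 0 \<and>
    searching u z \<tau> (\<Union>p<\<tau> headR 0. N (\<tau> queueA p)))"
  let ?pre = "Assign queueA (Const 0) (Cell giveA (reg stampR)) ;;
      inc stampR ;; put headR (Const 0) ;; put tailR (Const 1) ;; put foundR (Const 0)"
  let ?t = "Less (reg headR) (reg tailR)"
  let ?f = "\<lambda>\<tau> :: store. m - \<tau> headR 0"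
  let ?\<sigma> = "effect ?pre \<sigma>"
  have init: "I ?\<sigma>"
    using search_init[OF assms(2,4) _ assms(5), of "\<sigma> visA" z] assms(3,6)
    by (simp add: I_def searching_def z_def less_Suc_eq_le)
  have step: "exec explore \<rho> (80 * D + 80) (\<lambda>\<tau>. I \<tau> \<and> ?f \<tau> < ?f \<rho>)"
    if I: "I \<rho>" and fr: "agree_off (writes explore) ?\<sigma> \<rho>" and t: "test_val ?t \<rho>" for \<rho>
  proof -
    have "stored ?\<sigma>"
      using assms(1) by (simp add: stored_def)
    then have st: "stored \<rho>"
      using fr by (rule stored_agree_off) (simp add: explore_def visit_def)
    have z: "\<rho> stampR 0 = z"
      by (simp add: agree_offD[OF fr] explore_def visit_def z_def)
    have S: "searching u z \<rho> (\<Union>p<\<rho> headR 0. N (\<rho> queueA p))" and lt: "\<rho> headR 0 < \<rho> tailR 0"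
      using I t by (simp_all add: I_def)
    \<comment> \<open>The head is thus below \<open>m\<close>, so the measure really drops when it
      advances.\<close>
    have "\<rho> tailR 0 \<le> m"
      using S search.length_le by (auto simp: searching_def)
    then show ?thesis
      by (intro exec_mono[OF exec_explore[OF S st z refl lt]]) (use lt z in \<open>auto simp: I_def agree_off_def explore_def visit_def\<close>)
  qed
  show ?thesis
    unfolding bfs_def
  proof (rule exec_mono[OF exec_Seq_step[OF _ exec_While[of I, OF init step]]])
    have "max_cost ?pre + (?f ?\<sigma> * (1 + test_cost ?t + (80 * D + 80)) + (1 + test_cost ?t)) =
        m * (80 * D + 86) + 26"
      by (simp add: algebra_simps)
    also have "\<dots> \<le> m * (100 * (D + 1)) + 100 * (D + 1)"
      by (intro add_mono mult_left_mono) simp_all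
    also have "\<dots> = 100 * (D + 1) * (m + 1)"
      by (simp add: algebra_simps)
    finally show "max_cost ?pre + (?f ?\<sigma> * (1 + test_cost ?t + (80 * D + 80)) + (1 + test_cost ?t))
        \<le> 100 * (D + 1) * (m + 1)" .
  qed (auto simp: I_def z_def)
qed

lemma exec_augment:
  assumes S: "searching u z \<sigma> X" and "0 < \<sigma> foundR 0"
  shows "exec augment \<sigma> (100 * (m + 1)) (\<lambda>\<tau>. matching m N (\<tau> mateA) (\<tau> matchA) \<and>
    matched (\<tau> mateA) = insert u (matched (\<sigma> mateA)))"
proof -
  interpret search m N "\<sigma> mateA" "\<sigma> matchA" u z "\<sigma> visA" "\<sigma> parA" "\<sigma> queueA" "\<sigma> tailR 0"
    "\<sigma> foundR 0" "\<sigma> freeR 0" X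
    using S by (simp add: searching_def)
  define I where "I = (\<lambda>\<tau> :: store. flipping m N (\<tau> mateA) (\<tau> freeR 0) (\<tau> matchA)
    (matched (\<sigma> mateA)) (\<sigma> parA) (\<sigma> queueA) (\<tau> pathR 0))"
  let ?pre = "put pathR (Cell parA (reg freeR))"
  let ?post = "put leftR (Cell queueA (Const 0)) ;;
      Assign matchA (reg leftR) (reg freeR) ;;
      Assign mateA (reg freeR) (Add (reg leftR) (Const 1))"
  let ?t = "Less (Const 0) (reg pathR)"
  let ?f = "\<lambda>\<tau> :: store. \<tau> pathR 0"
  let ?\<sigma> = "effect ?pre \<sigma>"
  have init: "I ?\<sigma>"
    using flipping_init[OF assms(2)] by (simp add: I_def)
  have step: "exec flip_edge \<rho> 50 (\<lambda>\<tau>. I \<tau> \<and> ?f \<tau> < ?f \<rho>)"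
    if I: "I \<rho>" and fr: "agree_off (writes flip_edge) ?\<sigma> \<rho>" and t: "test_val ?t \<rho>" for \<rho>
  proof (rule exec_step)
    have st: "\<rho> parA = \<sigma> parA" "\<rho> queueA = \<sigma> queueA"
      by (simp_all add: agree_offD[OF fr] flip_edge_def)
    interpret F: flipping m N "\<rho> mateA" "\<rho> freeR 0" "\<rho> matchA" "matched (\<sigma> mateA)" "\<sigma> parA"
      "\<sigma> queueA" "\<rho> pathR 0"
      using I by (simp add: I_def)
    show "I (effect flip_edge \<rho>) \<and> ?f (effect flip_edge \<rho>) < ?f \<rho>"
      using F.flip F.par_match[of "\<rho> pathR 0"] t by (simp add: I_def flip_edge_def st)
  qed (simp_all add: flip_edge_def)
  show ?thesis
    unfolding augment_def
  proof (rule exec_mono[OF exec_Seq_step[OF _ exec_Seq[OF exec_While[of I, OF init step]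
            exec_step[where T = 20]]]])
    fix \<tau> assume I: "I \<tau> \<and> \<not> test_val ?t \<tau>"
      and fr: "agree_off (writes (While ?t flip_edge)) ?\<sigma> \<tau>"
    have st: "\<tau> queueA = \<sigma> queueA"
      by (simp add: agree_offD[OF fr] flip_edge_def)
    interpret F: flipping m N "\<tau> mateA" "\<tau> freeR 0" "\<tau> matchA" "matched (\<sigma> mateA)" "\<sigma> parA"
      "\<sigma> queueA" "\<tau> pathR 0"
      using conjunct1[OF I] by (simp add: I_def)
    show "matching m N (effect ?post \<tau> mateA) (effect ?post \<tau> matchA) \<and>
        matched (effect ?post \<tau> mateA) = insert u (matched (\<sigma> mateA))"
      using F.flip_root I root by (simp add: st Q_0)
  next
    \<comment> \<open>The measure is a position in the queue, so it starts below \<open>m\<close>;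
      parents precede their children.\<close>
    have "\<sigma> parA (\<sigma> freeR 0) < m"
      using par_less[OF vis_fv[OF assms(2)]] length_le by simp
    then show "max_cost ?pre + (?f ?\<sigma> * (1 + test_cost ?t + 50) + (1 + test_cost ?t) + 20)
        \<le> 100 * (m + 1)"
      by simp
  qed simp_all
qed

lemma exec_repair:
  assumes "stored \<sigma>"
    and M: "market m N (\<sigma> mateA) (\<sigma> matchA) L (\<sigma> priceA) (\<sigma> giveA) (\<sigma> giveR 0) {}"
    and L: "\<sigma> limitR 0 = L" "m \<le> L * L" and "0 < m" "\<sigma> stampR 0 = 0" "\<sigma> visA = (\<lambda>_. 0)"
  shows "exec repair \<sigma> (300 * (D + 1) * (m + 1) * (L + 1))
    (\<lambda>\<tau>. \<tau> 1 0 = (if saturable m N then 1 else 0))"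
proof -
  interpret M: market m N "\<sigma> mateA" "\<sigma> matchA" L "\<sigma> priceA" "\<sigma> giveA" "\<sigma> giveR 0" "{}"
    by (fact M)
  define K where "K = \<sigma> giveR 0"
  \<comment> \<open>Prices are forgotten now. While the flag is 1, the unmatched clauses are exactly
    the given-up ones from which no search has started yet.\<close>
  define I where "I = (\<lambda>\<tau> :: store. \<tau> stampR 0 \<le> K \<and>
    (\<tau> 1 0 = 0 \<and> \<not> saturable m N \<or>
     \<tau> 1 0 = 1 \<and> K \<le> L \<and> matching m N (\<tau> mateA) (\<tau> matchA) \<and>
     (\<forall>j. \<tau> stampR 0 \<le> j \<longrightarrow> j < K \<longrightarrow> \<sigma> giveA j \<notin> matched (\<tau> mateA)) \<and>
     {..<m} \<subseteq> \<sigma> giveA ` {\<tau> stampR 0..<K} \<union> matched (\<tau> mateA) \<and>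
     (\<forall>v. \<tau> visA v \<le> \<tau> stampR 0)))"
  let ?pre = "Cond (Less (reg limitR) (reg giveR)) (put 1 (Const 0)) (put 1 (Const 1))"
  let ?t = "Conj (Less (reg stampR) (reg giveR)) (Less (Const 0) (reg 1))"
  let ?body = "bfs ;; Cond (Less (Const 0) (reg foundR)) augment (put 1 (Const 0))"
  let ?T = "100 * (D + 1) * (m + 1) + (1 + test_cost (Less (Const 0) (reg foundR)) + 100 * (m + 1))"
  \<comment> \<open>A failed search clears the flag, which sends the measure to 0.\<close>
  let ?f = "\<lambda>\<tau> :: store. if \<tau> 1 0 = 0 then 0 else K - \<tau> stampR 0"
  let ?\<sigma> = "effect ?pre \<sigma>"
  have init: "I ?\<sigma>"
  proof (cases "L < K")
    case True
    have "\<not> saturable m N"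
    proof
      assume "saturable m N"
      then have "K * L \<le> m"
        using M.given_up_le by (simp add: K_def)
      also have "\<dots> \<le> L * L"
        by (fact L(2))
      \<comment> \<open>With \<open>L < K\<close>, a positive \<open>L\<close> would give
        \<open>L * L < K * L\<close>.\<close>
      finally have "L = 0"
        using True by simp
      then show False
        using L(2) \<open>0 < m\<close> by simp
    qed
    then show ?thesis
      using True assms by (simp add: I_def K_def)
  next
    case False
    moreover have "{..<m} \<subseteq> \<sigma> giveA ` {0..<K} \<union> matched (\<sigma> mateA)"
    proof
      fix v assume "v \<in> {..<m}"
      then show "v \<in> \<sigma> giveA ` {0..<K} \<union> matched (\<sigma> mateA)"
        using M.covered[of v] by (simp add: K_def lessThan_atLeast0)
    qed
    ultimately show ?thesis
      using assms M.matching_axioms M.give_unmatched by (auto simp: I_def K_def)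
  qed
  have step: "exec ?body \<rho> ?T (\<lambda>\<tau>. I \<tau> \<and> ?f \<tau> < ?f \<rho>)"
    if I: "I \<rho>" and fr: "agree_off (writes ?body) ?\<sigma> \<rho>" and t: "test_val ?t \<rho>" for \<rho>
  proof -
    note defs = bfs_def explore_def visit_def augment_def flip_edge_def
    define h u where "h = \<rho> stampR 0" and "u = \<sigma> giveA h"
    have "stored ?\<sigma>"
      using assms(1) by (simp add: stored_def)
    then have st: "stored \<rho>"
      using fr by (rule stored_agree_off) (simp add: defs)
    have same: "\<rho> giveA = \<sigma> giveA" "\<rho> giveR 0 = K"
      by (simp_all add: agree_offD[OF fr] defs K_def)
    have h: "h < K" and I': "\<rho> 1 0 = 1" "K \<le> L" "matching m N (\<rho> mateA) (\<rho> matchA)"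
      "\<And>j. h \<le> j \<Longrightarrow> j < K \<Longrightarrow> \<sigma> giveA j \<notin> matched (\<rho> mateA)"
      "{..<m} \<subseteq> \<sigma> giveA ` {h..<K} \<union> matched (\<rho> mateA)" "\<And>v. \<rho> visA v \<le> \<rho> stampR 0"
      using I t by (auto simp: I_def same h_def)
    have u: "\<rho> giveA (\<rho> stampR 0) = u" "u \<notin> matched (\<rho> mateA)" "u < m"
      using h I'(4) M.give_less by (auto simp: same u_def h_def K_def)
    show ?thesis
    proof (rule exec_mono[OF exec_Seq[OF exec_bfs[OF st I'(3) u I'(6)] exec_Cond]])
      fix \<tau>
      assume post: "\<tau> stampR 0 = Suc (\<rho> stampR 0) \<and>
          searching u (Suc (\<rho> stampR 0)) \<tau> (\<Union>p<\<tau> tailR 0. N (\<tau> queueA p))"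
        and fr: "agree_off (writes bfs) \<rho> \<tau>"
      then interpret search m N "\<tau> mateA" "\<tau> matchA" u "Suc h" "\<tau> visA" "\<tau> parA" "\<tau> queueA"
        "\<tau> tailR 0" "\<tau> foundR 0" "\<tau> freeR 0" "\<Union>p<\<tau> tailR 0. N (\<tau> queueA p)"
        by (simp add: searching_def h_def)
      have \<tau>: "\<tau> stampR 0 = Suc h" "\<tau> mateA = \<rho> mateA" "\<tau> 1 0 = 1"
        using post I'(1) by (simp_all add: h_def agree_offD[OF fr] defs)
      {
        assume "test_val (Less (Const 0) (reg foundR)) \<tau>"
        then have f: "0 < \<tau> foundR 0"
          by simp
        show "exec augment \<tau> (100 * (m + 1)) (\<lambda>\<tau>. I \<tau> \<and> ?f \<tau> < ?f \<rho>)"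
        proof (rule exec_mono[OF exec_augment[OF conjunct2[OF post] f] le_refl])
          fix \<upsilon>
          assume aug: "matching m N (\<upsilon> mateA) (\<upsilon> matchA) \<and>
              matched (\<upsilon> mateA) = insert u (matched (\<tau> mateA))"
            and fr: "agree_off (writes augment) \<tau> \<upsilon>"
          have \<upsilon>: "\<upsilon> stampR 0 = Suc h" "\<upsilon> 1 0 = 1" "\<upsilon> visA = \<tau> visA"
            using \<tau> by (simp_all add: agree_offD[OF fr] defs)
          \<comment> \<open>\<open>give\<close> is injective, so matching \<open>u\<close> does not
            affect the starting points still to come.\<close>
          have "\<sigma> giveA j \<noteq> u" if "Suc h \<le> j" "j < K" for j
            using inj_onD[OF M.inj_give, of j h] that by (auto simp: u_def K_def)
          moreover have "{h..<K} = insert h {Suc h..<K}"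
            using h by auto
          then have "\<sigma> giveA ` {h..<K} = insert u (\<sigma> giveA ` {Suc h..<K})"
            by (simp add: u_def)
          ultimately show "I \<upsilon> \<and> ?f \<upsilon> < ?f \<rho>"
            using aug I' h vis_le \<upsilon> by (auto simp: I_def \<tau>(2) h_def[symmetric])
        qed
      next
        assume "\<not> test_val (Less (Const 0) (reg foundR)) \<tau>"
        then have "\<not> saturable m N"
          using not_saturable by simp
        then show "exec (put 1 (Const 0)) \<tau> (100 * (m + 1)) (\<lambda>\<tau>. I \<tau> \<and> ?f \<tau> < ?f \<rho>)"
          using h I'(1) \<tau> by (intro exec_step) (simp_all add: I_def h_def[symmetric])
      }
    qed simp_all
  qed
  show ?thesis
    unfolding repair_def
  proof (rule exec_mono[OF exec_Seq_step[OF _ exec_While[of I, OF init step]]])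
    have "?f ?\<sigma> \<le> L"
      by (auto simp: K_def L)
    then have "?f ?\<sigma> * (1 + test_cost ?t + ?T) \<le> L * (1 + test_cost ?t + ?T)"
      by (rule mult_right_mono) simp
    moreover have "1 + test_cost ?t + ?T \<le> 300 * (D + 1) * (m + 1)"
      by (simp add: algebra_simps)
    then have "L * (1 + test_cost ?t + ?T) \<le> L * (300 * (D + 1) * (m + 1))"
      by (rule mult_left_mono) simp
    moreover have "max_cost ?pre + (1 + test_cost ?t) \<le> 300 * (D + 1) * (m + 1)"
      by (simp add: algebra_simps)
    ultimately have "max_cost ?pre + (?f ?\<sigma> * (1 + test_cost ?t + ?T) + (1 + test_cost ?t)) \<le>
        L * (300 * (D + 1) * (m + 1)) + 300 * (D + 1) * (m + 1)"
      by linarith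
    also have "\<dots> = 300 * (D + 1) * (m + 1) * (L + 1)"
      by (simp add: algebra_simps)
    finally show "max_cost ?pre + (?f ?\<sigma> * (1 + test_cost ?t + ?T) + (1 + test_cost ?t)) \<le>
        300 * (D + 1) * (m + 1) * (L + 1)" .
    fix \<tau>
    assume I: "I \<tau> \<and> \<not> test_val ?t \<tau>" and fr: "agree_off (writes (?pre ;; While ?t ?body)) \<sigma> \<tau>"
    have "\<tau> giveR 0 = K"
      by (simp add: agree_offD[OF fr] bfs_def explore_def visit_def augment_def flip_edge_def K_def)
    then show "\<tau> 1 0 = (if saturable m N then 1 else 0)"
      \<comment> \<open>If the flag is still 1, the stamp has reached \<open>K\<close> and no
        unmatched clause remains.\<close>
      using I matching.saturableI by (auto simp: I_def)
  qed simp
qed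

end

section \<open>Unfolding the input\<close>

definition pos :: "nat list list \<Rightarrow> nat \<Rightarrow> nat" where
  "pos F i = 2 + length (concat (map (\<lambda>C. length C # C) (take i F)))"

text \<open>Every occurrence of a variable yields \<open>d\<close> edges, so a repeated variable
  produces parallel edges; these are harmless because neighbourhoods are sets.\<close>

definition off :: "nat \<Rightarrow> nat list list \<Rightarrow> nat \<Rightarrow> nat" where
  "off d F i = length (concat (take i F)) * d"

lemma pos_0: "pos F 0 = 2"
  by (simp add: pos_def)

lemma pos_Suc: "i < length F \<Longrightarrow> pos F (Suc i) = pos F i + 1 + length (F ! i)"
  by (simp add: pos_def take_Suc_conv_app_nth)

lemma off_0: "off d F 0 = 0"
  by (simp add: off_def)

lemma off_Suc: "i < length F \<Longrightarrow> off d F (Suc i) = off d F i + length (F ! i) * d"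
  by (simp add: off_def take_Suc_conv_app_nth algebra_simps)

lemma input_store_pos:
  assumes "i < length F"
  shows "input_store (encode n F) 0 (pos F i) = length (F ! i)"
    and "t < length (F ! i) \<Longrightarrow> input_store (encode n F) 0 (pos F i + 1 + t) = F ! i ! t"
proof -
  let ?g = "\<lambda>C. length C # C"
  have "concat (map ?g F) = concat (map ?g (take i F @ F ! i # drop (Suc i) F))"
    using assms by (simp add: id_take_nth_drop[symmetric])
  then have eq: "encode n F = (n # length F # concat (map ?g (take i F))) @
      length (F ! i) # F ! i @ concat (map ?g (drop (Suc i) F))"
    by (simp add: encode_def)
  show "input_store (encode n F) 0 (pos F i) = length (F ! i)"
    unfolding input_store_def eq by (simp add: pos_def nth_append)
  show "input_store (encode n F) 0 (pos F i + 1 + t) = F ! i ! t" if "t < length (F ! i)"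
    unfolding input_store_def eq using that by (simp add: pos_def nth_append)
qed

text \<open>Consecutive copies differ by \<open>n + 1\<close>; \<open>reg 0\<close> is the first
  input cell and holds \<open>n\<close>.\<close>

definition copy_edge :: prog where
  "copy_edge =
     Assign edgeA (reg edgeR) (reg copyR) ;;
     inc edgeR ;;
     put copyR (Add (reg copyR) (Add (reg 0) (Const 1))) ;;
     inc countR"

definition copy_var :: "nat \<Rightarrow> prog" where
  "copy_var d =
     (put copyR (Cell 0 (reg posR)) ;; put countR (Const 0)) ;;
     While (Less (reg countR) (Const d)) copy_edge ;;
     inc posR"

definition copy_clause :: "nat \<Rightarrow> prog" where
  "copy_clause d =
     (Assign startA (reg clauseR) (reg edgeR) ;;
      put stopR (Add (Add (reg posR) (Const 1)) (Cell 0 (reg posR))) ;;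
      inc posR) ;;
     While (Less (reg posR) (reg stopR)) (copy_var d) ;;
     inc clauseR"

text \<open>The last assignment stores a sentinel, so that the block of the last clause has an end
  as well.\<close>

definition expand :: "nat \<Rightarrow> prog" where
  "expand d =
     put posR (Const 2) ;;
     While (Less (reg clauseR) (Cell 0 (Const 1))) (copy_clause d) ;;
     Assign startA (reg clauseR) (reg edgeR)"

lemma exec_copy_var:
  assumes "\<sigma> 0 0 = n" "\<sigma> edgeR 0 = e" "\<sigma> 0 (\<sigma> posR 0) = x"
  shows "exec (copy_var d) \<sigma> (50 * d + 50) (\<lambda>\<tau>. \<tau> edgeR 0 = e + d \<and> \<tau> posR 0 = Suc (\<sigma> posR 0) \<and>
    (\<forall>k<e. \<tau> edgeA k = \<sigma> edgeA k) \<and>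
    \<tau> edgeA ` {e..<e + d} = (\<lambda>j. x + j * Suc n) ` {..<d})"
proof -
  define I where "I = (\<lambda>\<tau> :: store. \<tau> countR 0 \<le> d \<and> \<tau> edgeR 0 = e + \<tau> countR 0 \<and>
    \<tau> copyR 0 = x + \<tau> countR 0 * Suc n \<and> (\<forall>k<e. \<tau> edgeA k = \<sigma> edgeA k) \<and>
    (\<forall>j<\<tau> countR 0. \<tau> edgeA (e + j) = x + j * Suc n))"
  let ?pre = "put copyR (Cell 0 (reg posR)) ;; put countR (Const 0)"
  let ?t = "Less (reg countR) (Const d)"
  let ?f = "\<lambda>\<tau> :: store. d - \<tau> countR 0"
  let ?\<sigma> = "effect ?pre \<sigma>"
  have init: "I ?\<sigma>"
    using assms by (simp add: I_def)
  have step: "exec copy_edge \<rho> 40 (\<lambda>\<tau>. I \<tau> \<and> ?f \<tau> < ?f \<rho>)"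
    if I: "I \<rho>" and fr: "agree_off (writes copy_edge) ?\<sigma> \<rho>" and t: "test_val ?t \<rho>" for \<rho>
  proof (rule exec_step)
    have "\<rho> 0 0 = n"
      using assms by (simp add: agree_offD[OF fr] copy_edge_def)
    then show "I (effect copy_edge \<rho>) \<and> ?f (effect copy_edge \<rho>) < ?f \<rho>"
      using I t by (auto simp: I_def copy_edge_def less_Suc_eq)
  qed (simp_all add: copy_edge_def)
  show ?thesis
    unfolding copy_var_def
  proof (rule exec_mono[OF exec_Seq_step[OF _ exec_Seq[OF exec_While[of I, OF init step]
            exec_step[where T = 10]]]])
    fix \<tau> assume I: "I \<tau> \<and> \<not> test_val ?t \<tau>"
      and fr: "agree_off (writes (While ?t copy_edge)) ?\<sigma> \<tau>"
    have "\<tau> posR 0 = \<sigma> posR 0"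
      by (simp add: agree_offD[OF fr] copy_edge_def)
    moreover have "{e..<e + d} = (\<lambda>j. e + j) ` {..<d}"
      by (simp add: lessThan_atLeast0 add.commute)
    ultimately show "effect (inc posR) \<tau> edgeR 0 = e + d \<and>
        effect (inc posR) \<tau> posR 0 = Suc (\<sigma> posR 0) \<and>
        (\<forall>k<e. effect (inc posR) \<tau> edgeA k = \<sigma> edgeA k) \<and>
        effect (inc posR) \<tau> edgeA ` {e..<e + d} = (\<lambda>j. x + j * Suc n) ` {..<d}"
      using I by (auto simp: I_def image_image)
  qed simp_all
qed

lemma exec_copy_clause:
  assumes "\<sigma> 0 0 = n" "\<sigma> edgeR 0 = e" "\<sigma> posR 0 = p" "\<sigma> 0 p = length C"
    and C: "\<And>t. t < length C \<Longrightarrow> \<sigma> 0 (p + 1 + t) = C ! t"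
  shows "exec (copy_clause d) \<sigma> (length C * (50 * d + 60) + 60) (\<lambda>\<tau>.
    \<tau> edgeR 0 = e + length C * d \<and> \<tau> posR 0 = p + 1 + length C \<and> \<tau> clauseR 0 = Suc (\<sigma> clauseR 0) \<and>
    \<tau> startA = (\<sigma> startA)(\<sigma> clauseR 0 := e) \<and> (\<forall>k<e. \<tau> edgeA k = \<sigma> edgeA k) \<and>
    \<tau> edgeA ` {e..<e + length C * d} = copies n d C)"
proof -
  define I where "I = (\<lambda>\<tau> :: store. \<exists>t\<le>length C. \<tau> posR 0 = p + 1 + t \<and> \<tau> edgeR 0 = e + t * d \<and>
    (\<forall>k<e. \<tau> edgeA k = \<sigma> edgeA k) \<and> \<tau> edgeA ` {e..<e + t * d} = copies n d (take t C))"
  let ?pre = "Assign startA (reg clauseR) (reg edgeR) ;;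
      put stopR (Add (Add (reg posR) (Const 1)) (Cell 0 (reg posR))) ;; inc posR"
  let ?t = "Less (reg posR) (reg stopR)"
  let ?f = "\<lambda>\<tau> :: store. p + 1 + length C - \<tau> posR 0"
  let ?\<sigma> = "effect ?pre \<sigma>"
  have init: "I ?\<sigma>"
    using assms by (simp add: I_def copies_def)
  have step: "exec (copy_var d) \<rho> (50 * d + 50) (\<lambda>\<tau>. I \<tau> \<and> ?f \<tau> < ?f \<rho>)"
    if I: "I \<rho>" and fr: "agree_off (writes (copy_var d)) ?\<sigma> \<rho>" and t: "test_val ?t \<rho>" for \<rho>
  proof -
    obtain t where t': "\<rho> posR 0 = p + 1 + t" "\<rho> edgeR 0 = e + t * d"
      "\<forall>k<e. \<rho> edgeA k = \<sigma> edgeA k" "\<rho> edgeA ` {e..<e + t * d} = copies n d (take t C)"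
      using I by (auto simp: I_def)
    have st: "\<rho> stopR 0 = p + 1 + length C" "\<rho> 0 = \<sigma> 0" "\<rho> 0 0 = n"
      using assms by (simp_all add: agree_offD[OF fr] copy_var_def copy_edge_def)
    then have lt: "t < length C"
      using t t' by simp
    then have "\<rho> 0 (\<rho> posR 0) = C ! t"
      using C t' st by simp
    from exec_copy_var[OF st(3) t'(2) this] show ?thesis
    proof (rule exec_mono)
      fix \<tau>
      assume post: "\<tau> edgeR 0 = e + t * d + d \<and> \<tau> posR 0 = Suc (\<rho> posR 0) \<and>
        (\<forall>k<e + t * d. \<tau> edgeA k = \<rho> edgeA k) \<and>
        \<tau> edgeA ` {e + t * d..<e + t * d + d} = (\<lambda>j. C ! t + j * Suc n) ` {..<d}"
      have "{e..<e + Suc t * d} = {e..<e + t * d} \<union> {e + t * d..<e + t * d + d}"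
        by auto
      moreover have "\<tau> edgeA ` {e..<e + t * d} = \<rho> edgeA ` {e..<e + t * d}"
        using post by (intro image_cong) auto
      ultimately have "\<tau> edgeA ` {e..<e + Suc t * d} = copies n d (take (Suc t) C)"
        using post t' lt by (auto simp: image_Un copies_def take_Suc_conv_app_nth)
      then have "I \<tau>"
        unfolding I_def using post t' lt by (intro exI[of _ "Suc t"]) simp
      then show "I \<tau> \<and> ?f \<tau> < ?f \<rho>"
        using post t' lt by simp
    qed simp
  qed
  show ?thesis
    unfolding copy_clause_def
  proof (rule exec_mono[OF exec_Seq_step[OF _ exec_Seq[OF exec_While[of I, OF init step]
            exec_step[where T = 10]]]])
    fix \<tau> assume I: "I \<tau> \<and> \<not> test_val ?t \<tau>"
      and fr: "agree_off (writes (While ?t (copy_var d))) ?\<sigma> \<tau>"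
    have "\<tau> startA = (\<sigma> startA)(\<sigma> clauseR 0 := e)" "\<tau> clauseR 0 = \<sigma> clauseR 0"
      "\<tau> stopR 0 = p + 1 + length C"
      using assms by (simp_all add: agree_offD[OF fr] copy_var_def copy_edge_def)
    then show "effect (inc clauseR) \<tau> edgeR 0 = e + length C * d \<and>
        effect (inc clauseR) \<tau> posR 0 = p + 1 + length C \<and>
        effect (inc clauseR) \<tau> clauseR 0 = Suc (\<sigma> clauseR 0) \<and>
        effect (inc clauseR) \<tau> startA = (\<sigma> startA)(\<sigma> clauseR 0 := e) \<and>
        (\<forall>k<e. effect (inc clauseR) \<tau> edgeA k = \<sigma> edgeA k) \<and>
        effect (inc clauseR) \<tau> edgeA ` {e..<e + length C * d} = copies n d C"
      using I by (auto simp: I_def)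
  next
    show "max_cost ?pre + (?f ?\<sigma> * (1 + test_cost ?t + (50 * d + 50)) + (1 + test_cost ?t) + 10)
        \<le> length C * (50 * d + 60) + 60"
      using assms by (simp add: add_mult_distrib2)
  qed (simp_all add: fun_upd_def)
qed

lemma exec_expand:
  assumes F: "is_pi_sigma n m s F" and "\<sigma> = input_store (encode n F)"
  shows "exec (expand d) \<sigma> (100 * (m + 1) * (s * (d + 2) + 1)) (\<lambda>\<tau>.
    (\<forall>i\<le>m. \<tau> startA i = off d F i) \<and>
    (\<forall>i<m. \<tau> edgeA ` {off d F i..<off d F (Suc i)} = copies n d (F ! i)))"
proof -
  have len: "length F = m" and s: "\<And>i. i < m \<Longrightarrow> length (F ! i) \<le> s"
    using F unfolding is_pi_sigma_def by (auto dest!: nth_mem)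
  have inp: "\<sigma> 0 0 = n" "\<sigma> 0 1 = m" "\<And>a. a \<noteq> 0 \<Longrightarrow> \<sigma> a = (\<lambda>_. 0)"
    using assms(2) len by (simp_all add: input_store_def encode_def)
  define I where "I = (\<lambda>\<tau> :: store. \<tau> clauseR 0 \<le> m \<and> \<tau> posR 0 = pos F (\<tau> clauseR 0) \<and>
    \<tau> edgeR 0 = off d F (\<tau> clauseR 0) \<and>
    (\<forall>i<\<tau> clauseR 0. \<tau> startA i = off d F i \<and>
      \<tau> edgeA ` {off d F i..<off d F (Suc i)} = copies n d (F ! i)))"
  let ?pre = "put posR (Const 2)"
  let ?post = "Assign startA (reg clauseR) (reg edgeR)"
  let ?t = "Less (reg clauseR) (Cell 0 (Const 1))"
  let ?f = "\<lambda>\<tau> :: store. m - \<tau> clauseR 0"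
  let ?\<sigma> = "effect ?pre \<sigma>"
  \<comment> \<open>Blocks already written lie below the current edge position, so later clauses
    leave them intact.\<close>
  have mono: "off d F i \<le> off d F k" if "i \<le> k" "k \<le> m" for i k
    using that by (induction k rule: dec_induct) (simp_all add: off_Suc len)
  have init: "I ?\<sigma>"
    using inp by (simp add: I_def pos_0 off_0)
  have step: "exec (copy_clause d) \<rho> (s * (50 * d + 60) + 60) (\<lambda>\<tau>. I \<tau> \<and> ?f \<tau> < ?f \<rho>)"
    if I: "I \<rho>" and fr: "agree_off (writes (copy_clause d)) ?\<sigma> \<rho>" and t: "test_val ?t \<rho>" for \<rho>
  proof -
    define i where "i = \<rho> clauseR 0"
    have \<rho>: "\<rho> 0 = \<sigma> 0"
      by (simp add: agree_offD[OF fr] copy_clause_def copy_var_def copy_edge_def)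
    then have i: "i < m"
      using t inp by (simp add: i_def)
    have I': "\<rho> posR 0 = pos F i" "\<rho> edgeR 0 = off d F i" "\<And>k. k < i \<Longrightarrow> \<rho> startA k = off d F k"
      "\<And>k. k < i \<Longrightarrow> \<rho> edgeA ` {off d F k..<off d F (Suc k)} = copies n d (F ! k)"
      using I by (simp_all add: I_def i_def)
    have "\<rho> 0 0 = n" "\<rho> 0 (pos F i) = length (F ! i)"
      "\<And>t. t < length (F ! i) \<Longrightarrow> \<rho> 0 (pos F i + 1 + t) = F ! i ! t"
      using inp(1) input_store_pos[where i = i and F = F and n = n] i len assms(2)
      unfolding \<rho> by simp_all
    from exec_copy_clause[OF this(1) I'(2,1) this(2,3)] show ?thesis
    proof (rule exec_mono)
      show "length (F ! i) * (50 * d + 60) + 60 \<le> s * (50 * d + 60) + 60"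
        using s[OF i] by (intro add_right_mono mult_right_mono) simp_all
      fix \<tau>
      assume post: "\<tau> edgeR 0 = off d F i + length (F ! i) * d \<and>
        \<tau> posR 0 = pos F i + 1 + length (F ! i) \<and> \<tau> clauseR 0 = Suc (\<rho> clauseR 0) \<and>
        \<tau> startA = (\<rho> startA)(\<rho> clauseR 0 := off d F i) \<and>
        (\<forall>k<off d F i. \<tau> edgeA k = \<rho> edgeA k) \<and>
        \<tau> edgeA ` {off d F i..<off d F i + length (F ! i) * d} = copies n d (F ! i)"
      have "\<tau> edgeA ` {off d F k..<off d F (Suc k)} = copies n d (F ! k)" if "k < Suc i" for k
      proof (cases "k = i")
        case True
        then show ?thesis
          using post i by (simp add: off_Suc len)
      next
        case False
        then have "k < i"
          using that by simp
        then have "\<tau> edgeA ` {off d F k..<off d F (Suc k)} = \<rho> edgeA ` {off d F k..<off d F (Suc k)}"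
          using post mono[of "Suc k" i] i by (intro image_cong) auto
        then show ?thesis
          using I'(4)[OF \<open>k < i\<close>] by simp
      qed
      then have "I \<tau>"
        using post I' i len by (auto simp: I_def i_def[symmetric] pos_Suc off_Suc less_Suc_eq)
      then show "I \<tau> \<and> ?f \<tau> < ?f \<rho>"
        using post i by (simp add: i_def)
    qed
  qed
  show ?thesis
    unfolding expand_def
  proof (rule exec_mono[OF exec_Seq_step[OF _ exec_Seq[OF exec_While[of I, OF init step]
            exec_step[where T = 10]]]])
    fix \<tau> assume I: "I \<tau> \<and> \<not> test_val ?t \<tau>"
      and fr: "agree_off (writes (While ?t (copy_clause d))) ?\<sigma> \<tau>"
    have "\<tau> 0 1 = m"
      using inp by (simp add: agree_offD[OF fr] copy_clause_def copy_var_def copy_edge_def)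
    then have "\<tau> clauseR 0 = m"
      using I by (simp add: I_def)
    then show "(\<forall>i\<le>m. effect ?post \<tau> startA i = off d F i) \<and>
        (\<forall>i<m. effect ?post \<tau> edgeA ` {off d F i..<off d F (Suc i)} = copies n d (F ! i))"
      using I by (auto simp: I_def le_eq_less_or_eq)
  next
    have "max_cost ?pre + (?f ?\<sigma> * (1 + test_cost ?t + (s * (50 * d + 60) + 60)) +
        (1 + test_cost ?t) + 10) = m * (s * (50 * d + 60) + 66) + 19"
      using inp by (simp add: algebra_simps)
    also have "\<dots> \<le> m * (100 * (s * (d + 2) + 1)) + 100 * (s * (d + 2) + 1)"
      by (intro add_mono mult_left_mono) (simp_all add: algebra_simps)
    also have "\<dots> = 100 * (m + 1) * (s * (d + 2) + 1)"
      by (simp add: algebra_simps)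
    finally show "max_cost ?pre + (?f ?\<sigma> * (1 + test_cost ?t + (s * (50 * d + 60) + 60)) +
        (1 + test_cost ?t) + 10) \<le> 100 * (m + 1) * (s * (d + 2) + 1)" .
  qed simp_all
qed

text \<open>The next square after that of \<open>l\<close> is obtained by adding
  \<open>2 * l + 1\<close>.\<close>

definition square_root :: prog where
  "square_root =
     While (Less (reg squareR) (Cell 0 (Const 1)))
       (put squareR (Add (reg squareR) (Add (Add (reg limitR) (reg limitR)) (Const 1))) ;;
        inc limitR)"

lemma exec_square_root:
  assumes "\<sigma> 0 1 = m" "\<sigma> squareR 0 = 0" "\<sigma> limitR 0 = 0"
  shows "exec square_root \<sigma> (40 * (m + 1))
    (\<lambda>\<tau>. m \<le> \<tau> limitR 0 * \<tau> limitR 0 \<and> (\<forall>k<\<tau> limitR 0. k * k < m))"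
proof -
  define I where "I = (\<lambda>\<tau> :: store. \<tau> squareR 0 = \<tau> limitR 0 * \<tau> limitR 0 \<and>
    (\<forall>k<\<tau> limitR 0. k * k < m))"
  let ?t = "Less (reg squareR) (Cell 0 (Const 1))"
  let ?P = "put squareR (Add (reg squareR) (Add (Add (reg limitR) (reg limitR)) (Const 1))) ;;
        inc limitR"
  let ?f = "\<lambda>\<tau> :: store. m - \<tau> squareR 0"
  have init: "I \<sigma>"
    using assms by (simp add: I_def)
  have step: "exec ?P \<rho> 25 (\<lambda>\<tau>. I \<tau> \<and> ?f \<tau> < ?f \<rho>)"
    if I: "I \<rho>" and fr: "agree_off (writes ?P) \<sigma> \<rho>" and t: "test_val ?t \<rho>" for \<rho>
  proof (rule exec_step)
    have "\<rho> 0 1 = m"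
      using assms by (simp add: agree_offD[OF fr])
    then show "I (effect ?P \<rho>) \<and> ?f (effect ?P \<rho>) < ?f \<rho>"
      using I t by (auto simp: I_def less_Suc_eq)
  qed simp_all
  show ?thesis
    unfolding square_root_def
  proof (rule exec_mono[OF exec_While[of I, OF init step]])
    fix \<tau> assume I: "I \<tau> \<and> \<not> test_val ?t \<tau>" and fr: "agree_off (writes (While ?t ?P)) \<sigma> \<tau>"
    have "\<tau> 0 1 = m"
      using assms by (simp add: agree_offD[OF fr])
    then show "m \<le> \<tau> limitR 0 * \<tau> limitR 0 \<and> (\<forall>k<\<tau> limitR 0. k * k < m)"
      using I by (simp add: I_def)
  qed (use assms in simp_all)
qed

section \<open>The decision procedure\<close>

definition decide :: "nat \<Rightarrow> prog" where
  "decide d = expand d ;; square_root ;; auction ;; repair"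

text \<open>The phases are joined through explicit stores, since \<open>layout\<close> is
  instantiated with the arrays that the expansion leaves. That \<open>k * k < m\<close> below
  \<open>L\<close> expresses minimality and will yield \<open>L <= sqrt m + 1\<close>.\<close>

lemma exec_decide:
  assumes F: "is_pi_sigma n m s F" and "0 < m"
  shows "\<exists>L. (\<forall>k<L. k * k < m) \<and>
    exec (decide d) (input_store (encode n F)) (700 * (s * (d + 2) + 1) * (m + 1) * (L + 1))
      (\<lambda>\<tau>. \<tau> 1 0 = (if has_c_monomial (Suc d) F then 1 else 0))"
proof -
  let ?\<sigma> = "input_store (encode n F)"
  let ?W = "s * (d + 2) + 1"
  have len: "length F = m" and s: "\<And>i. i < m \<Longrightarrow> length (F ! i) \<le> s"
    using F unfolding is_pi_sigma_def by (auto dest!: nth_mem)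
  have inp: "?\<sigma> 0 1 = m" "\<And>a. a \<noteq> 0 \<Longrightarrow> ?\<sigma> a = (\<lambda>_. 0)"
    using len by (simp_all add: input_store_def encode_def)
  note pre = expand_def copy_clause_def copy_var_def copy_edge_def
  obtain t1 \<sigma>1 where 1: "run (expand d) ?\<sigma> t1 \<sigma>1" "t1 \<le> 100 * (m + 1) * ?W"
    "\<And>i. i \<le> m \<Longrightarrow> \<sigma>1 startA i = off d F i"
    "\<And>i. i < m \<Longrightarrow> \<sigma>1 edgeA ` {off d F i..<off d F (Suc i)} = copies n d (F ! i)"
    using exec_expand[OF F refl, of d] by (auto simp: exec_def)
  note fr1 = agree_offD[OF run_agree_off[OF 1(1)]]
  obtain t2 \<sigma>2 where 2: "run square_root \<sigma>1 t2 \<sigma>2" "t2 \<le> 40 * (m + 1)"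
    "m \<le> \<sigma>2 limitR 0 * \<sigma>2 limitR 0" "\<And>k. k < \<sigma>2 limitR 0 \<Longrightarrow> k * k < m"
    using exec_square_root[of \<sigma>1 m] inp by (auto simp: exec_def fr1 pre)
  note fr2 = agree_offD[OF run_agree_off[OF 2(1)]]
  define L where "L = \<sigma>2 limitR 0"
  interpret layout m "d * s" "\<sigma>1 startA" "\<sigma>1 edgeA"
  proof
    fix u assume u: "u < m"
    have "\<sigma>1 startA (Suc u) = \<sigma>1 startA u + length (F ! u) * d"
      using 1(3)[of u] 1(3)[of "Suc u"] u len by (simp add: off_Suc)
    then show "\<sigma>1 startA u \<le> \<sigma>1 startA (Suc u)" "\<sigma>1 startA (Suc u) \<le> \<sigma>1 startA u + d * s"
      using s[OF u] by simp_all
  qed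
  have N: "N u = copies n d (F ! u)" if "u < m" for u
    using 1(3)[of u] 1(3)[of "Suc u"] 1(4)[of u] that by (simp add: N_def)
  have st2: "stored \<sigma>2"
    using inp by (simp add: stored_def fr2 square_root_def fr1 pre)
  obtain t3 \<sigma>3 where 3: "run auction \<sigma>2 t3 \<sigma>3" "t3 \<le> 200 * (d * s + 1) * (m * L + m + 1)"
    "market m N (\<sigma>3 mateA) (\<sigma>3 matchA) L (\<sigma>3 priceA) (\<sigma>3 giveA) (\<sigma>3 giveR 0) {}"
    using exec_auction[OF st2 L_def[symmetric]] inp
    by (auto simp: exec_def fr2 square_root_def fr1 pre)
  note auction = auction_def scan_def settle_def compare_edge_def advance_def
  note fr3 = agree_offD[OF run_agree_off[OF 3(1)]]
  have st3: "stored \<sigma>3"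
    using stored_agree_off[OF st2 run_agree_off[OF 3(1)]] by (simp add: auction)
  obtain t4 \<tau> where 4: "run repair \<sigma>3 t4 \<tau>" "t4 \<le> 300 * (d * s + 1) * (m + 1) * (L + 1)"
    "\<tau> 1 0 = (if saturable m N then 1 else 0)"
    using exec_repair[OF st3 3(3)] 2(3) inp \<open>0 < m\<close>
    by (auto simp: exec_def L_def fr3 auction fr2 square_root_def fr1 pre)
  have "run (decide d) ?\<sigma> (t1 + (t2 + (t3 + t4))) \<tau>"
    unfolding decide_def using 1(1) 2(1) 3(1) 4(1) by (intro run_Seq)
  \<comment> \<open>The four phases take at most 100, 40, 200 and 300 times \<open>?B\<close>, which
    is 640 in total.\<close>
  moreover have "t1 + (t2 + (t3 + t4)) \<le> 700 * ?W * (m + 1) * (L + 1)"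
  proof -
    let ?B = "?W * ((m + 1) * (L + 1))"
    have W: "d * s + 1 \<le> ?W"
      by (simp add: algebra_simps)
    have mL: "m + 1 \<le> (m + 1) * (L + 1)" "m * L + m + 1 \<le> (m + 1) * (L + 1)"
      by simp_all
    have "t1 \<le> 100 * ?B"
      using 1(2) mult_le_mono1[OF mL(1), of ?W] by (simp only: mult_ac)
    moreover have "t2 \<le> 40 * ?B"
      using 2(2) mult_le_mono[OF le_add2[of 1 "s * (d + 2)"] mL(1)] by simp
    moreover have "t3 \<le> 200 * ?B"
      using 3(2) mult_le_mono[OF W mL(2)] unfolding mult.assoc by linarith
    moreover have "t4 \<le> 300 * ?B"
      using 4(2) mult_le_mono1[OF W, of "(m + 1) * (L + 1)"] unfolding mult.assoc by linarith
    ultimately have "t1 + (t2 + (t3 + t4)) \<le> 700 * ?B"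
      by linarith
    then show ?thesis
      by (simp only: mult.assoc)
  qed
  moreover have "\<tau> 1 0 = (if has_c_monomial (Suc d) F then 1 else 0)"
    using 4(3) has_c_monomial_iff_saturable[OF F] saturable_cong[OF N] by simp
  ultimately show ?thesis
    using 2(4) unfolding exec_def L_def by blast
qed

text \<open>\<open>K\<close> is chosen before \<open>c\<close>, whereas the program may depend on
  \<open>c\<close>: the number \<open>c - 1\<close> of copies is a literal of its text.\<close>

theorem theorem7:
  "\<exists>K::real. \<forall>c::nat. c > 2 \<longrightarrow>
     (\<exists>P::prog. \<forall>(n::nat) (m::nat) (s::nat) F.
        1 \<le> m \<longrightarrow> 1 \<le> s \<longrightarrow> is_pi_sigma n m s F \<longrightarrow>
        decides_within P (encode n F) (has_c_monomial c F)
          (K * real c * real m * real s * sqrt (real m + real c * real n)))"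
\<comment> \<open>12600 = 700 * 3 * 2 * 3, from the factor 700 of the procedure and the estimates
  \<open>s * (c + 1) + 1 <= 3 * s * c\<close>, \<open>m + 1 <= 2 * m\<close> and
  \<open>L + 1 <= 3 * sqrt m\<close>.\<close>
proof (rule exI[of _ 12600], intro allI impI)
  fix c :: nat
  assume c: "2 < c"
  show "\<exists>P::prog. \<forall>(n::nat) (m::nat) (s::nat) F.
        1 \<le> m \<longrightarrow> 1 \<le> s \<longrightarrow> is_pi_sigma n m s F \<longrightarrow>
        decides_within P (encode n F) (has_c_monomial c F)
          (12600 * real c * real m * real s * sqrt (real m + real c * real n))"
  proof (intro exI allI impI)
    fix n m s F
    assume m: "1 \<le> m" and s: "1 \<le> s" and F: "is_pi_sigma n m s F"
    obtain L where L: "\<And>k. k < L \<Longrightarrow> k * k < m"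
      and ex: "exec (decide (c - 1)) (input_store (encode n F))
        (700 * (s * (c - 1 + 2) + 1) * (m + 1) * (L + 1))
        (\<lambda>\<tau>. \<tau> 1 0 = (if has_c_monomial (Suc (c - 1)) F then 1 else 0))"
      using exec_decide[OF F, of "c - 1"] m by auto
    have sqrt_m: "1 \<le> sqrt (real m)"
      using m by simp
    have "real L \<le> sqrt (real m) + 1"
    proof (cases L)
      case (Suc k)
      then have "real k ^ 2 < real m"
        using L[of k] by (simp add: power2_eq_square flip: of_nat_mult)
      then show ?thesis
        using Suc real_less_rsqrt by fastforce
    qed simp
    then have L': "real (L + 1) \<le> 3 * sqrt (real m)"
      unfolding of_nat_add of_nat_1 using sqrt_m by linarith
    have "1 * 1 \<le> s * c"
      using s c by (intro mult_le_mono) simp_all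
    moreover have "s * 1 \<le> s * c"
      using c by (intro mult_le_mono) simp_all
    moreover have "s * (c - 1 + 2) + 1 = s * c + s * 1 + 1 * 1"
      using c by (simp flip: add_mult_distrib2)
    ultimately have "s * (c - 1 + 2) + 1 \<le> 3 * (s * c)"
      by linarith
    then have W: "real (s * (c - 1 + 2) + 1) \<le> 3 * (real s * real c)"
      by (metis of_nat_le_iff of_nat_mult of_nat_numeral)
    have "real (700 * (s * (c - 1 + 2) + 1) * (m + 1) * (L + 1)) =
        700 * (real (s * (c - 1 + 2) + 1) * (real (m + 1) * real (L + 1)))"
      by (simp only: of_nat_mult mult.assoc of_nat_numeral)
    also have "\<dots> \<le> 700 * ((3 * (real s * real c)) * ((2 * real m) * (3 * sqrt (real m))))"
      using m W L' by (intro mult_left_mono mult_mono) simp_all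
    also have "\<dots> = 12600 * real c * real m * real s * sqrt (real m)"
      by simp
    also have "\<dots> \<le> 12600 * real c * real m * real s * sqrt (real m + real c * real n)"
      by (intro mult_left_mono) simp_all
    finally have *: "real (700 * (s * (c - 1 + 2) + 1) * (m + 1) * (L + 1))
        \<le> 12600 * real c * real m * real s * sqrt (real m + real c * real n)" .
    obtain t \<tau> where "run (decide (c - 1)) (input_store (encode n F)) t \<tau>"
      "t \<le> 700 * (s * (c - 1 + 2) + 1) * (m + 1) * (L + 1)"
      "\<tau> 1 0 = (if has_c_monomial (Suc (c - 1)) F then 1 else 0)"
      using ex unfolding exec_def by blast
    moreover have "Suc (c - 1) = c"
      using c by simp
    moreover have "real t \<le> 12600 * real c * real m * real s * sqrt (real m + real c * real n)"
      using of_nat_mono[OF calculation(2), where ?'a = real] * by (rule order_trans)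
    ultimately show "decides_within (decide (c - 1)) (encode n F) (has_c_monomial c F)
        (12600 * real c * real m * real s * sqrt (real m + real c * real n))"
      unfolding decides_within_def by (intro exI[of _ t] exI[of _ \<tau>]) simp
  qed
qed

end
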